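(* Let $(G_m,S)$ be a random Coxeter system with a countably infinite, arbitrarily enumerated set $S=\{s_1,s_2,s_3,\ldots\}$ of generators (the $s_i$ pairwise distinct), where the random Coxeter matrix $m=(m(s,t))_{s,t\in S}$ satisfies: (i) $m(s,t)=m(t,s)$ and $m(s,s)=1$ for all $s,t\in S$; (ii) if $s\neq t$ and $s'\neq t'$, and neither $(s,t)=(s',t')$ nor $(s,t)=(t',s')$, as ordered pairs, then $m(s,t)$ and $m(s',t')$ are independent, identically distributed; (iii) for some $p\in[0,1]$, for all $s\neq t$: $\mathrm{prob}(m(s,t)=2)=p$ and $\mathrm{prob}(m(s,t)\in\{3,4,\ldots,\infty\})=1-p$. Then, almost surely, for all $k\in\mathbb{N}$ \[ \lim_{N\rightarrow\infty}\varphi\left(\left(\frac{\delta(s_1)+\ldots+\delta(s_N)}{\sqrt{N}}\right)^k\right)=\begin{cases}0 & \text{if } k \text{ is odd},\\[4pt] \displaystyle\sum_{V}p^{\#I(V)} & \text{if } k=2r \text{ is even},\end{cases} \] where the sum runs over all pair-partitions $V$ of $\{1,\ldots,k\}$ (into $r$ two-element sets) and $I(V)$ denotes the set of inversions of $V$.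
   Context: For a (realization of the) Coxeter matrix $m$, with entries in $\mathbb{N}\cup\{\infty\}$, the Coxeter group $G_m$ is the group with generating set $S$ and defining relations $(ss')^{m(s,s')}=\mathrm{Id}$ for all $s,s'\in S$ with $m(s,s')<\infty$. The group algebra $\mathbb{C}G_m$ consists of finite formal sums $\sum_{x\in G_m}a_x\delta(x)$ with convolution product determined by $\delta(x)\delta(y)=\delta(xy)$; the canonical trace is $\varphi\left(\sum_x a_x\delta(x)\right)=a_{\mathrm{Id}}$. A pair-partition of $\{1,\ldots,2r\}$ is a partition all of whose blocks have exactly two elements. Given a pair-partition $V=\{V_1,\ldots,V_r\}$ of $\{1,\ldots,2r\}$, write $V_i=\{e_i,f_i\}$ with $e_i<f_i$ and number the blocks so that $e_i<e_j$ if $i<j$. The set of inversions of $V$ is $I(V)=\{(i,j):e_i<e_j<f_i<f_j\}$, and $\#I(V)$ is its cardinality. Convention: $0^0=1$.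
   Formalization: In (ii), independence is taken to be mutual independence of the whole family m(s,t) over unordered pairs s≠t; with merely pairwise independence the claim fails (m(s_i,s_j)=2 iff fair bits x_i=x_j gives 1/4 instead of p^3=1/8 in the 6th moment). *)

theory Defs
  imports
    "HOL-Algebra.Module"
    "HOL-Library.Extended_Nat"
    "HOL-Library.Disjoint_Sets"
    "HOL-Probability.Probability"
begin

section \<open>Groups given by generators and relations\<close>

text \<open>
  A word is a list of signed letters: \<open>(a, True)\<close> stands for the generator \<open>a\<close> and
  \<open>(a, False)\<close> for its formal inverse.  The group with generating set \<open>S\<close> and
  defining relations \<open>r = Id\<close>, for \<open>r \<in> R\<close>, consists of the words over \<open>S\<close> modulo the least
  congruence that contains free cancellation and the relations.
\<close>

type_synonym 'a signed_word = "('a \<times> bool) list"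

definition words_over :: "'a set \<Rightarrow> 'a signed_word set" where
  "words_over S = lists (S \<times> UNIV)"

inductive pres_cong :: "'a set \<Rightarrow> 'a signed_word set \<Rightarrow> 'a signed_word \<Rightarrow> 'a signed_word \<Rightarrow> bool"
  for S :: "'a set" and R :: "'a signed_word set" where
  refl: "u \<in> words_over S \<Longrightarrow> pres_cong S R u u"
| sym: "pres_cong S R u v \<Longrightarrow> pres_cong S R v u"
| trans: "pres_cong S R u v \<Longrightarrow> pres_cong S R v w \<Longrightarrow> pres_cong S R u w"
| append: "pres_cong S R u u' \<Longrightarrow> pres_cong S R v v' \<Longrightarrow> pres_cong S R (u @ v) (u' @ v')"
| cancel: "a \<in> S \<Longrightarrow> pres_cong S R [(a, b), (a, \<not> b)] []"
| relator: "r \<in> R \<Longrightarrow> r \<in> words_over S \<Longrightarrow> pres_cong S R r []"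

definition pres_rel :: "'a set \<Rightarrow> 'a signed_word set \<Rightarrow> 'a signed_word rel" where
  "pres_rel S R = {(u, v). pres_cong S R u v}"

definition presented_group :: "'a set \<Rightarrow> 'a signed_word set \<Rightarrow> 'a signed_word set monoid" where
  "presented_group S R =
    \<lparr>carrier = words_over S // pres_rel S R,
     monoid.mult = (\<lambda>A B. pres_rel S R `` {u @ v | u v. u \<in> A \<and> v \<in> B}),
     one = pres_rel S R `` {[]}\<rparr>"

definition pres_gen :: "'a set \<Rightarrow> 'a signed_word set \<Rightarrow> 'a \<Rightarrow> 'a signed_word set" where
  "pres_gen S R a = pres_rel S R `` {[(a, True)]}"

lemma pres_cong_words:
  assumes "pres_cong S R u v"
  shows "u \<in> words_over S \<and> v \<in> words_over S"
  using assms by induction (auto simp: words_over_def)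

lemma equiv_pres_rel: "equiv (words_over S) (pres_rel S R)"
proof (rule equivI)
  show "pres_rel S R \<subseteq> words_over S \<times> words_over S"
    using pres_cong_words by (fastforce simp: pres_rel_def)
  show "refl_on (words_over S) (pres_rel S R)"
    by (auto simp: refl_on_def pres_rel_def intro: pres_cong.refl)
  show "sym (pres_rel S R)"
    by (auto simp: sym_def pres_rel_def intro: pres_cong.sym)
  show "trans (pres_rel S R)"
    by (auto simp: trans_def pres_rel_def intro: pres_cong.trans)
qed

lemma presented_group_mult_class:
  assumes "u \<in> words_over S" "v \<in> words_over S"
  shows "(pres_rel S R `` {u}) \<otimes>\<^bsub>presented_group S R\<^esub> (pres_rel S R `` {v}) = pres_rel S R `` {u @ v}"
proof -
  have "pres_cong S R (u @ v) x \<longleftrightarrow>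
      (\<exists>u' v'. pres_cong S R u u' \<and> pres_cong S R v v' \<and> pres_cong S R (u' @ v') x)" for x
    using assms by (meson pres_cong.refl pres_cong.append pres_cong.sym pres_cong.trans)
  then show ?thesis
    by (auto simp: presented_group_def pres_rel_def)
qed

lemma group_presented_group: "group (presented_group S R)"
proof -
  let ?G = "presented_group S R"
  let ?c = "\<lambda>u. pres_rel S R `` {u}"
  have nil: "[] \<in> words_over S"
    by (simp add: words_over_def)
  have app: "u @ v \<in> words_over S" if "u \<in> words_over S" "v \<in> words_over S" for u v
    using that by (simp add: words_over_def)
  have carr: "carrier ?G = words_over S // pres_rel S R"
    and one: "\<one>\<^bsub>?G\<^esub> = ?c []"
    by (simp_all add: presented_group_def)
  have inv: "\<exists>v\<in>words_over S. pres_cong S R (v @ u) []" if "u \<in> words_over S" for u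
    using that
  proof (induction u)
    case Nil
    then show ?case using nil by (auto intro: pres_cong.refl)
  next
    case (Cons x u)
    obtain a b where x: "x = (a, b)" by force
    have a: "a \<in> S" and u: "u \<in> words_over S"
      using Cons.prems by (auto simp: x words_over_def)
    obtain v where v: "v \<in> words_over S" "pres_cong S R (v @ u) []"
      using Cons.IH u by blast
    have "pres_cong S R ([(a, \<not> b), (a, b)] @ u) ([] @ u)"
      using pres_cong.cancel[OF a, of R "\<not> b"] u by (intro pres_cong.append pres_cong.refl) auto
    then have "pres_cong S R (v @ ([(a, \<not> b), (a, b)] @ u)) (v @ ([] @ u))"
      using pres_cong.append[OF pres_cong.refl[OF v(1)]] by blast
    then have "pres_cong S R ((v @ [(a, \<not> b)]) @ x # u) []"
      using v(2) pres_cong.trans by (fastforce simp: x)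
    moreover have "v @ [(a, \<not> b)] \<in> words_over S"
      using v(1) a by (simp add: words_over_def)
    ultimately show ?case by blast
  qed
  show ?thesis
  proof (rule groupI)
    show "x \<otimes>\<^bsub>?G\<^esub> y \<in> carrier ?G" if "x \<in> carrier ?G" "y \<in> carrier ?G" for x y
      using that by (auto simp: carr presented_group_mult_class app elim!: quotientE intro!: quotientI)
    show "\<one>\<^bsub>?G\<^esub> \<in> carrier ?G"
      using nil by (auto simp: carr one intro: quotientI)
    show "x \<otimes>\<^bsub>?G\<^esub> y \<otimes>\<^bsub>?G\<^esub> z = x \<otimes>\<^bsub>?G\<^esub> (y \<otimes>\<^bsub>?G\<^esub> z)"
      if "x \<in> carrier ?G" "y \<in> carrier ?G" "z \<in> carrier ?G" for x y z
      using that by (auto simp: carr presented_group_mult_class app elim!: quotientE)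
    show "\<one>\<^bsub>?G\<^esub> \<otimes>\<^bsub>?G\<^esub> x = x" if "x \<in> carrier ?G" for x
      using that nil by (auto simp: carr one presented_group_mult_class elim!: quotientE)
    show "\<exists>y\<in>carrier ?G. y \<otimes>\<^bsub>?G\<^esub> x = \<one>\<^bsub>?G\<^esub>" if x: "x \<in> carrier ?G" for x
    proof -
      obtain u where u: "u \<in> words_over S" "x = ?c u"
        using x by (auto simp: carr elim!: quotientE)
      obtain v where v: "v \<in> words_over S" "pres_cong S R (v @ u) []"
        using inv u(1) by blast
      have "?c (v @ u) = ?c []"
        using v(2) by (intro equiv_class_eq[OF equiv_pres_rel]) (simp add: pres_rel_def)
      then show ?thesis
        using u v by (intro bexI[of _ "?c v"])
          (auto simp: carr one presented_group_mult_class intro: quotientI)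
    qed
  qed
qed


section \<open>Coxeter groups\<close>

definition coxeter_relators :: "'a set \<Rightarrow> ('a \<Rightarrow> 'a \<Rightarrow> enat) \<Rightarrow> 'a signed_word set" where
  "coxeter_relators S m =
    {concat (replicate n [(a, True), (b, True)]) | a b n. a \<in> S \<and> b \<in> S \<and> m a b = enat n}"

definition coxeter_group :: "'a set \<Rightarrow> ('a \<Rightarrow> 'a \<Rightarrow> enat) \<Rightarrow> 'a signed_word set monoid" where
  "coxeter_group S m = presented_group S (coxeter_relators S m)"

definition coxeter_gen :: "'a set \<Rightarrow> ('a \<Rightarrow> 'a \<Rightarrow> enat) \<Rightarrow> 'a \<Rightarrow> 'a signed_word set" where
  "coxeter_gen S m a = pres_gen S (coxeter_relators S m) a"


section \<open>The complex group algebra and its canonical trace\<close>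

text \<open>
  The element \<open>\<Sum>x. a x \<delta>(x)\<close> is represented by its finitely supported coefficient function \<open>a\<close>.
\<close>

definition ga_delta :: "'g \<Rightarrow> 'g \<Rightarrow> complex" where
  "ga_delta x = (\<lambda>y. if y = x then 1 else 0)"

definition ga_supp :: "('g \<Rightarrow> complex) \<Rightarrow> 'g set" where
  "ga_supp f = {x. f x \<noteq> 0}"

definition group_algebra :: "('g, 'e) monoid_scheme \<Rightarrow> (complex, 'g \<Rightarrow> complex) module" where
  "group_algebra G =
    \<lparr>carrier = {f. finite (ga_supp f) \<and> ga_supp f \<subseteq> carrier G},
     monoid.mult = (\<lambda>f g x. \<Sum>y\<in>ga_supp f. \<Sum>z\<in>ga_supp g. f y * g z * ga_delta (y \<otimes>\<^bsub>G\<^esub> z) x),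
     one = ga_delta \<one>\<^bsub>G\<^esub>,
     zero = (\<lambda>x. 0),
     add = (\<lambda>f g x. f x + g x),
     module.smult = (\<lambda>c f x. c * f x)\<rparr>"

definition canonical_trace :: "('g, 'e) monoid_scheme \<Rightarrow> ('g \<Rightarrow> complex) \<Rightarrow> complex" where
  "canonical_trace G f = f \<one>\<^bsub>G\<^esub>"

lemma group_algebra_mult_superset:
  assumes "finite A" "finite B" "ga_supp f \<subseteq> A" "ga_supp g \<subseteq> B"
  shows "(f \<otimes>\<^bsub>group_algebra G\<^esub> g) x = (\<Sum>y\<in>A. \<Sum>z\<in>B. f y * g z * ga_delta (y \<otimes>\<^bsub>G\<^esub> z) x)"
proof -
  have "(f \<otimes>\<^bsub>group_algebra G\<^esub> g) x
      = (\<Sum>y\<in>ga_supp f. \<Sum>z\<in>ga_supp g. f y * g z * ga_delta (y \<otimes>\<^bsub>G\<^esub> z) x)"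
    by (simp add: group_algebra_def)
  also have "\<dots> = (\<Sum>y\<in>ga_supp f. \<Sum>z\<in>B. f y * g z * ga_delta (y \<otimes>\<^bsub>G\<^esub> z) x)"
    using assms by (intro sum.cong refl sum.mono_neutral_left) (auto simp: ga_supp_def)
  also have "\<dots> = (\<Sum>y\<in>A. \<Sum>z\<in>B. f y * g z * ga_delta (y \<otimes>\<^bsub>G\<^esub> z) x)"
    using assms by (intro sum.mono_neutral_left) (auto simp: ga_supp_def)
  finally show ?thesis .
qed

lemma group_algebra_supp_mult:
  "ga_supp (f \<otimes>\<^bsub>group_algebra G\<^esub> g) \<subseteq> (\<lambda>(y, z). y \<otimes>\<^bsub>G\<^esub> z) ` (ga_supp f \<times> ga_supp g)"
proof
  fix x assume "x \<in> ga_supp (f \<otimes>\<^bsub>group_algebra G\<^esub> g)"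
  then have "(f \<otimes>\<^bsub>group_algebra G\<^esub> g) x \<noteq> 0"
    by (simp only: ga_supp_def mem_Collect_eq not_False_eq_True)
  then have "(\<Sum>y\<in>ga_supp f. \<Sum>z\<in>ga_supp g. f y * g z * ga_delta (y \<otimes>\<^bsub>G\<^esub> z) x) \<noteq> 0"
    by (simp add: group_algebra_def)
  then obtain y where y: "y \<in> ga_supp f"
    "(\<Sum>z\<in>ga_supp g. f y * g z * ga_delta (y \<otimes>\<^bsub>G\<^esub> z) x) \<noteq> 0"
    by (meson sum.not_neutral_contains_not_neutral)
  then obtain z where "z \<in> ga_supp g" "f y * g z * ga_delta (y \<otimes>\<^bsub>G\<^esub> z) x \<noteq> 0"
    by (meson sum.not_neutral_contains_not_neutral)
  then show "x \<in> (\<lambda>(y, z). y \<otimes>\<^bsub>G\<^esub> z) ` (ga_supp f \<times> ga_supp g)"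
    using y(1) by (auto simp: ga_delta_def split: if_splits)
qed

lemma group_algebra_delta_mult:
  "ga_delta x \<otimes>\<^bsub>group_algebra G\<^esub> ga_delta y = ga_delta (x \<otimes>\<^bsub>G\<^esub> y)"
proof -
  have "ga_supp (ga_delta z) = {z}" for z :: 'a
    by (auto simp: ga_supp_def ga_delta_def)
  then show ?thesis
    by (simp add: group_algebra_def) (simp add: ga_delta_def fun_eq_iff)
qed

lemma ring_group_algebra:
  assumes "group G"
  shows "ring (group_algebra G)"
proof -
  interpret G: group G by fact
  let ?A = "group_algebra G"
  have carr: "f \<in> carrier ?A \<longleftrightarrow> finite (ga_supp f) \<and> ga_supp f \<subseteq> carrier G" for f
    by (simp add: group_algebra_def)
  have add: "(f \<oplus>\<^bsub>?A\<^esub> g) = (\<lambda>x. f x + g x)" for f g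
    by (simp add: group_algebra_def)
  have zero: "\<zero>\<^bsub>?A\<^esub> = (\<lambda>x. 0)"
    by (simp add: group_algebra_def)
  have one: "\<one>\<^bsub>?A\<^esub> = ga_delta \<one>\<^bsub>G\<^esub>"
    by (simp add: group_algebra_def)
  have supp_one: "ga_supp (ga_delta \<one>\<^bsub>G\<^esub>) = {\<one>\<^bsub>G\<^esub>}"
    by (auto simp: ga_supp_def ga_delta_def)
  have supp_add: "ga_supp (\<lambda>x. f x + g x) \<subseteq> ga_supp f \<union> ga_supp g" for f g :: "'a \<Rightarrow> complex"
    by (auto simp: ga_supp_def)
  have add_closed: "f \<oplus>\<^bsub>?A\<^esub> g \<in> carrier ?A" if "f \<in> carrier ?A" "g \<in> carrier ?A" for f g
    using that supp_add[of f g] unfolding carr add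
    by (meson finite_UnI finite_subset Un_least order_trans)
  have mult_closed: "f \<otimes>\<^bsub>?A\<^esub> g \<in> carrier ?A" if "f \<in> carrier ?A" "g \<in> carrier ?A" for f g
  proof -
    have "(\<lambda>(y, z). y \<otimes>\<^bsub>G\<^esub> z) ` (ga_supp f \<times> ga_supp g) \<subseteq> carrier G"
      using that by (auto simp: carr)
    moreover have "finite ((\<lambda>(y, z). y \<otimes>\<^bsub>G\<^esub> z) ` (ga_supp f \<times> ga_supp g))"
      using that by (simp add: carr)
    ultimately show ?thesis
      unfolding carr using group_algebra_supp_mult[of G f g] by (meson finite_subset order_trans)
  qed
  have "abelian_group ?A"
  proof (rule abelian_groupI)
    fix f assume f: "f \<in> carrier ?A"
    have "ga_supp (\<lambda>x. - f x) = ga_supp f"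
      by (simp add: ga_supp_def)
    then show "\<exists>g\<in>carrier ?A. g \<oplus>\<^bsub>?A\<^esub> f = \<zero>\<^bsub>?A\<^esub>"
      using f by (intro bexI[of _ "\<lambda>x. - f x"]) (auto simp: carr add zero)
  qed (use add_closed in \<open>auto simp: add zero carr add.assoc add.commute ga_supp_def\<close>)
  moreover have "Group.monoid ?A"
  proof (rule monoidI)
    show "\<one>\<^bsub>?A\<^esub> \<in> carrier ?A"
      by (simp add: one carr supp_one)
    show "\<one>\<^bsub>?A\<^esub> \<otimes>\<^bsub>?A\<^esub> f = f" if f: "f \<in> carrier ?A" for f
    proof
      fix x
      have "(\<one>\<^bsub>?A\<^esub> \<otimes>\<^bsub>?A\<^esub> f) x = (\<Sum>z\<in>ga_supp f. f z * ga_delta (\<one>\<^bsub>G\<^esub> \<otimes>\<^bsub>G\<^esub> z) x)"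
        by (simp add: one group_algebra_def supp_one) (simp add: ga_delta_def)
      also have "\<dots> = (\<Sum>z\<in>ga_supp f. if z = x then f z else 0)"
        using f by (intro sum.cong refl) (auto simp: carr ga_delta_def subset_iff)
      finally show "(\<one>\<^bsub>?A\<^esub> \<otimes>\<^bsub>?A\<^esub> f) x = f x"
        using f by (simp add: carr) (simp add: ga_supp_def)
    qed
    show "f \<otimes>\<^bsub>?A\<^esub> \<one>\<^bsub>?A\<^esub> = f" if f: "f \<in> carrier ?A" for f
    proof
      fix x
      have "(f \<otimes>\<^bsub>?A\<^esub> \<one>\<^bsub>?A\<^esub>) x = (\<Sum>z\<in>ga_supp f. f z * ga_delta (z \<otimes>\<^bsub>G\<^esub> \<one>\<^bsub>G\<^esub>) x)"
        by (simp add: one group_algebra_def supp_one) (simp add: ga_delta_def)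
      also have "\<dots> = (\<Sum>z\<in>ga_supp f. if z = x then f z else 0)"
        using f by (intro sum.cong refl) (auto simp: carr ga_delta_def subset_iff)
      finally show "(f \<otimes>\<^bsub>?A\<^esub> \<one>\<^bsub>?A\<^esub>) x = f x"
        using f by (simp add: carr) (simp add: ga_supp_def)
    qed
    show "f \<otimes>\<^bsub>?A\<^esub> g \<otimes>\<^bsub>?A\<^esub> h = f \<otimes>\<^bsub>?A\<^esub> (g \<otimes>\<^bsub>?A\<^esub> h)"
      if f: "f \<in> carrier ?A" and g: "g \<in> carrier ?A" and h: "h \<in> carrier ?A" for f g h
    proof
      fix x
      define A where "A = ga_supp f"
      define B where "B = ga_supp g"
      define C where "C = ga_supp h"
      define P where "P = (\<lambda>(y, z). y \<otimes>\<^bsub>G\<^esub> z) ` (A \<times> B)"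
      define Q where "Q = (\<lambda>(y, z). y \<otimes>\<^bsub>G\<^esub> z) ` (B \<times> C)"
      have fin: "finite A" "finite B" "finite C" "finite P" "finite Q"
        and sub: "A \<subseteq> carrier G" "B \<subseteq> carrier G" "C \<subseteq> carrier G"
        using f g h by (auto simp: A_def B_def C_def P_def Q_def carr)
      have "(f \<otimes>\<^bsub>?A\<^esub> g \<otimes>\<^bsub>?A\<^esub> h) x
          = (\<Sum>q\<in>P. \<Sum>c\<in>C. (f \<otimes>\<^bsub>?A\<^esub> g) q * h c * ga_delta (q \<otimes>\<^bsub>G\<^esub> c) x)"
        using fin group_algebra_supp_mult[of G f g]
        by (intro group_algebra_mult_superset) (auto simp: A_def B_def C_def P_def)
      also have "\<dots> = (\<Sum>q\<in>P. \<Sum>c\<in>C. \<Sum>a\<in>A. \<Sum>b\<in>B.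
          f a * g b * ga_delta (a \<otimes>\<^bsub>G\<^esub> b) q * h c * ga_delta (q \<otimes>\<^bsub>G\<^esub> c) x)"
        by (simp add: group_algebra_mult_superset[OF fin(1,2), folded A_def B_def] A_def B_def
            sum_distrib_right)
      also have "\<dots> = (\<Sum>c\<in>C. \<Sum>a\<in>A. \<Sum>b\<in>B. \<Sum>q\<in>P.
          f a * g b * ga_delta (a \<otimes>\<^bsub>G\<^esub> b) q * h c * ga_delta (q \<otimes>\<^bsub>G\<^esub> c) x)"
        by (simp only: sum.swap[where A = P])
      also have "\<dots> = (\<Sum>c\<in>C. \<Sum>a\<in>A. \<Sum>b\<in>B. \<Sum>q\<in>P.
          if q = a \<otimes>\<^bsub>G\<^esub> b then f a * g b * h c * ga_delta (a \<otimes>\<^bsub>G\<^esub> b \<otimes>\<^bsub>G\<^esub> c) x else 0)"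
        by (intro sum.cong) (auto simp: ga_delta_def)
      also have "\<dots> = (\<Sum>c\<in>C. \<Sum>a\<in>A. \<Sum>b\<in>B. f a * g b * h c * ga_delta (a \<otimes>\<^bsub>G\<^esub> b \<otimes>\<^bsub>G\<^esub> c) x)"
        using fin by (intro sum.cong refl) (auto simp: P_def)
      also have "\<dots> = (\<Sum>a\<in>A. \<Sum>b\<in>B. \<Sum>c\<in>C. f a * g b * h c * ga_delta (a \<otimes>\<^bsub>G\<^esub> b \<otimes>\<^bsub>G\<^esub> c) x)"
        by (simp only: sum.swap[where A = C])
      also have "\<dots> = (\<Sum>a\<in>A. \<Sum>b\<in>B. \<Sum>c\<in>C. f a * g b * h c * ga_delta (a \<otimes>\<^bsub>G\<^esub> (b \<otimes>\<^bsub>G\<^esub> c)) x)"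
        using sub by (intro sum.cong) (auto simp: G.m_assoc subset_iff)
      also have "\<dots> = (\<Sum>a\<in>A. \<Sum>b\<in>B. \<Sum>c\<in>C. \<Sum>q\<in>Q.
          if q = b \<otimes>\<^bsub>G\<^esub> c then f a * g b * h c * ga_delta (a \<otimes>\<^bsub>G\<^esub> (b \<otimes>\<^bsub>G\<^esub> c)) x else 0)"
        using fin by (intro sum.cong refl) (auto simp: Q_def)
      also have "\<dots> = (\<Sum>a\<in>A. \<Sum>b\<in>B. \<Sum>c\<in>C. \<Sum>q\<in>Q.
          f a * (g b * h c * ga_delta (b \<otimes>\<^bsub>G\<^esub> c) q) * ga_delta (a \<otimes>\<^bsub>G\<^esub> q) x)"
        by (intro sum.cong) (auto simp: ga_delta_def)
      also have "\<dots> = (\<Sum>a\<in>A. \<Sum>q\<in>Q. \<Sum>b\<in>B. \<Sum>c\<in>C.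
          f a * (g b * h c * ga_delta (b \<otimes>\<^bsub>G\<^esub> c) q) * ga_delta (a \<otimes>\<^bsub>G\<^esub> q) x)"
        by (simp only: sum.swap[where A = Q])
      also have "\<dots> = (\<Sum>a\<in>A. \<Sum>q\<in>Q. f a * (g \<otimes>\<^bsub>?A\<^esub> h) q * ga_delta (a \<otimes>\<^bsub>G\<^esub> q) x)"
        by (simp add: group_algebra_mult_superset[OF fin(2,3), folded B_def C_def] B_def C_def
            sum_distrib_right sum_distrib_left)
      also have "\<dots> = (f \<otimes>\<^bsub>?A\<^esub> (g \<otimes>\<^bsub>?A\<^esub> h)) x"
        using fin group_algebra_supp_mult[of G g h]
        by (intro group_algebra_mult_superset[symmetric]) (auto simp: A_def B_def C_def Q_def)
      finally show "(f \<otimes>\<^bsub>?A\<^esub> g \<otimes>\<^bsub>?A\<^esub> h) x = (f \<otimes>\<^bsub>?A\<^esub> (g \<otimes>\<^bsub>?A\<^esub> h)) x" .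
    qed
  qed (rule mult_closed)
  moreover have "(f \<oplus>\<^bsub>?A\<^esub> g) \<otimes>\<^bsub>?A\<^esub> h = f \<otimes>\<^bsub>?A\<^esub> h \<oplus>\<^bsub>?A\<^esub> g \<otimes>\<^bsub>?A\<^esub> h"
    and "h \<otimes>\<^bsub>?A\<^esub> (f \<oplus>\<^bsub>?A\<^esub> g) = h \<otimes>\<^bsub>?A\<^esub> f \<oplus>\<^bsub>?A\<^esub> h \<otimes>\<^bsub>?A\<^esub> g"
    if f: "f \<in> carrier ?A" and g: "g \<in> carrier ?A" and h: "h \<in> carrier ?A" for f g h
  proof -
    define A where "A = ga_supp f \<union> ga_supp g"
    define C where "C = ga_supp h"
    have fin: "finite A" "finite C"
      and sub: "ga_supp f \<subseteq> A" "ga_supp g \<subseteq> A" "ga_supp h \<subseteq> C" "ga_supp (f \<oplus>\<^bsub>?A\<^esub> g) \<subseteq> A"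
      using f g h supp_add[of f g] by (auto simp: A_def C_def carr add)
    note ex = group_algebra_mult_superset[OF fin] group_algebra_mult_superset[OF fin(2,1)]
    show "(f \<oplus>\<^bsub>?A\<^esub> g) \<otimes>\<^bsub>?A\<^esub> h = f \<otimes>\<^bsub>?A\<^esub> h \<oplus>\<^bsub>?A\<^esub> g \<otimes>\<^bsub>?A\<^esub> h"
      unfolding add[of "_ \<otimes>\<^bsub>_\<^esub> _"] fun_eq_iff
      by (simp add: ex sub) (simp add: add algebra_simps sum.distrib)
    show "h \<otimes>\<^bsub>?A\<^esub> (f \<oplus>\<^bsub>?A\<^esub> g) = h \<otimes>\<^bsub>?A\<^esub> f \<oplus>\<^bsub>?A\<^esub> h \<otimes>\<^bsub>?A\<^esub> g"
      unfolding add[of "_ \<otimes>\<^bsub>_\<^esub> _"] fun_eq_iff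
      by (simp add: ex sub) (simp add: add algebra_simps sum.distrib)
  qed
  ultimately show ?thesis
    by (intro ringI)
qed


section \<open>Pair-partitions and inversions\<close>

definition pair_partitions :: "nat \<Rightarrow> nat set set set" where
  "pair_partitions k = {V. partition_on {1..k} V \<and> (\<forall>B\<in>V. card B = 2)}"

text \<open>
  For a block \<open>B = {e, f}\<close> with \<open>e < f\<close> we have \<open>e = Min B\<close> and \<open>f = Max B\<close>.  The blocks are
  numbered by increasing minimum; \<open>pair_block V i\<close> is the block with number \<open>i \<in> {1..card V}\<close>.
\<close>

definition pair_block :: "nat set set \<Rightarrow> nat \<Rightarrow> nat set" where
  "pair_block V i = (THE B. B \<in> V \<and> Min B = sorted_list_of_set (Min ` V) ! (i - 1))"

definition inversions :: "nat set set \<Rightarrow> (nat \<times> nat) set" where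
  "inversions V = {(i, j). i \<in> {1..card V} \<and> j \<in> {1..card V} \<and>
     Min (pair_block V i) < Min (pair_block V j) \<and>
     Min (pair_block V j) < Max (pair_block V i) \<and>
     Max (pair_block V i) < Max (pair_block V j)}"

lemma pair_block_bij:
  assumes "V \<in> pair_partitions k"
  shows "bij_betw (pair_block V) {1..card V} V"
proof -
  have part: "partition_on {1..k} V" and two: "\<And>B. B \<in> V \<Longrightarrow> card B = 2"
    using assms by (auto simp: pair_partitions_def)
  have V_sub: "\<And>B. B \<in> V \<Longrightarrow> B \<subseteq> {1..k}"
    using part by (auto simp: partition_on_def)
  have finV: "finite V"
    using finite_elements[OF _ part] by simp
  have MinB: "Min B \<in> B" if "B \<in> V" for B
    using that two[OF that] by (metis Min_in card.empty card.infinite zero_neq_numeral)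
  have inj: "inj_on Min V"
    using part MinB by (intro inj_onI) (metis disjointD disjoint_iff partition_on_def)
  define L where "L = sorted_list_of_set (Min ` V)"
  have L: "set L = Min ` V" "distinct L" "length L = card V"
    using finV inj by (simp_all add: L_def card_image)
  have bL: "bij_betw (\<lambda>i. L ! (i - 1)) {1..card V} (Min ` V)"
  proof -
    have "bij_betw (\<lambda>i. i - 1) {1..card V} {..<card V}"
      by (rule bij_betw_byWitness[of _ Suc]) auto
    then have "bij_betw ((!) L \<circ> (\<lambda>i. i - 1)) {1..card V} (Min ` V)"
      using bij_betw_nth[OF L(2), of "{..<card V}" "Min ` V"] L by (intro bij_betw_trans) auto
    then show ?thesis by (simp add: comp_def)
  qed
  have "pair_block V = the_inv_into V Min \<circ> (\<lambda>i. L ! (i - 1))"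
    by (simp add: pair_block_def the_inv_into_def L_def fun_eq_iff)
  moreover have "bij_betw (the_inv_into V Min \<circ> (\<lambda>i. L ! (i - 1))) {1..card V} V"
    using bL inj by (intro bij_betw_trans[OF bL] bij_betw_the_inv_into) (simp add: bij_betw_def)
  ultimately show ?thesis
    by simp
qed

end

theory Submission
  imports Defs "HOL-Library.Sublist"
begin

text \<open>
  Expanding the power, the \<open>k\<close>-th moment is \<open>N\<^sup>-\<^sup>k\<^sup>/\<^sup>2\<close> times the number of words of length \<open>k\<close> in
  \<open>s\<^sub>1, \<dots>, s\<^sub>N\<close> that represent the identity (\<open>trace_power_generator_sum\<close>).  Two facts about
  Coxeter groups reduce this count to combinatorics.

  A word in which some letter occurs exactly once is not the identity
  (\<open>trivial_no_single_letter\<close>).  So every letter of a trivial word occurs at least twice, and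
  trivial words in which some letter occurs more than twice have fewer than \<open>k/2\<close> distinct
  letters; there are only \<open>o(N\<^sup>k\<^sup>/\<^sup>2)\<close> of those.

  A word in which every letter occurs exactly twice is the identity if and only if any two letters
  whose occurrences interlace commute (\<open>trivial_pair_word_iff\<close>).  If \<open>s u s\<close> is a shortest
  repetition in the word, the letters of \<open>u\<close> are distinct and all interlace with \<open>s\<close>.  Either
  hypothesis forces them to commute with \<open>s\<close>, so that both occurrences of \<open>s\<close> can be removed and
  induction applies.  Both facts come from the geometric representation; because \<open>u\<close> has distinct
  letters, the positivity that is needed can be read off directly, without the theory of positive
  roots.

  The positions of equal letters in such a word form a pair-partition \<open>V\<close> of \<open>{1..k}\<close>, and the
  interlacing pairs of letters correspond to the inversions of \<open>V\<close>.  There are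
  \<open>N (N - 1) \<dots> (N - k/2 + 1)\<close> words with a given \<open>V\<close>, and each is trivial with probability
  \<open>p\<close> to the number of inversions, by independence.  This gives the limit in expectation
  (\<open>expected_pair_words_tendsto\<close>).

  The limit is almost sure because the normalised count of the trivial words with every letter twice
  has variance \<open>O(N\<^sup>-\<^sup>2)\<close>: two of these words can be correlated only if they depend on the same label
  \<open>m(s, t)\<close> and so share two letters, which leaves at most \<open>k - 2\<close> distinct letters for the two
  words together.  The variances are summable (\<open>AE_crossing_sums_concentrate\<close>).
\<close>

section \<open>A representation of the Coxeter group on functions\<close>

text \<open>
  This is \<open>-2 B(a, b)\<close> for the bilinear form \<open>B\<close> of the Coxeter matrix,
  \<open>B(a, b) = - cos (\<pi> / m(a, b))\<close>, with \<open>B(a, b) = -1\<close> for an infinite label.  The label \<open>1\<close> on the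
  diagonal gives the value \<open>2 cos \<pi> = -2\<close> without a case distinction.
\<close>

definition cox_coeff :: "('a \<Rightarrow> 'a \<Rightarrow> enat) \<Rightarrow> 'a \<Rightarrow> 'a \<Rightarrow> real" where
  "cox_coeff m a b = (case m a b of enat n \<Rightarrow> 2 * cos (pi / real n) | \<infinity> \<Rightarrow> 2)"

text \<open>
  The contragredient of the geometric representation.  A function \<open>f\<close> on the generators stands for
  the linear form with value \<open>f r\<close> on the simple root of \<open>r\<close>; in this picture generators that are
  zeros of \<open>f\<close> fix \<open>f\<close>, which is what the arguments below exploit.
\<close>

definition dual_refl :: "('a \<Rightarrow> 'a \<Rightarrow> enat) \<Rightarrow> 'a \<Rightarrow> ('a \<Rightarrow> real) \<Rightarrow> 'a \<Rightarrow> real" where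
  "dual_refl m t f = (\<lambda>r. f r + cox_coeff m r t * f t)"

text \<open>
  A letter and its formal inverse act in the same way, since reflections are involutions.
\<close>

definition dual_act :: "('a \<Rightarrow> 'a \<Rightarrow> enat) \<Rightarrow> 'a signed_word \<Rightarrow> ('a \<Rightarrow> real) \<Rightarrow> 'a \<Rightarrow> real" where
  "dual_act m w = foldr (\<lambda>x. dual_refl m (fst x)) w"

text \<open>
  Off the diagonal the labels \<open>0\<close> and \<open>1\<close> are excluded: \<open>0\<close> would stand for an empty relator, and
  \<open>1\<close> would identify two generators.
\<close>

definition coxeter_matrix :: "'a set \<Rightarrow> ('a \<Rightarrow> 'a \<Rightarrow> enat) \<Rightarrow> bool" where
  "coxeter_matrix S m \<longleftrightarrow> (\<forall>a\<in>S. m a a = 1) \<and>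
     (\<forall>a\<in>S. \<forall>b\<in>S. m a b = m b a \<and> (a \<noteq> b \<longrightarrow> 2 \<le> m a b))"

lemma dual_act_simps [simp]:
  "dual_act m [] f = f"
  "dual_act m (x # w) f = dual_refl m (fst x) (dual_act m w f)"
  "dual_act m (u @ v) f = dual_act m u (dual_act m v f)"
  by (simp_all add: dual_act_def)

lemma cox_coeff_self: "m a a = 1 \<Longrightarrow> cox_coeff m a a = -2"
  by (simp add: cox_coeff_def one_enat_def)

lemma cox_coeff_nonneg:
  assumes "2 \<le> m a b"
  shows "0 \<le> cox_coeff m a b"
proof (cases "m a b")
  case (enat n)
  with assms have n: "2 \<le> real n" by (simp add: numeral_eq_enat)
  then have "pi / real n \<le> pi / 2" by (intro divide_left_mono) auto
  then have "0 \<le> cos (pi / real n)"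
    using n by (intro cos_ge_zero) (auto simp: divide_simps intro: order_trans[of _ 0])
  then show ?thesis by (simp add: cox_coeff_def enat)
qed (simp add: cox_coeff_def)

lemma cox_coeff_eq_0:
  assumes "2 \<le> m a b" "cox_coeff m a b = 0"
  shows "m a b = 2"
proof (cases "m a b")
  case (enat n)
  with assms have n: "2 \<le> real n" by (simp add: numeral_eq_enat)
  have "\<not> 2 < real n"
  proof
    assume "2 < real n"
    then have "pi / real n < pi / 2" by (intro divide_strict_left_mono) auto
    then have "0 < cos (pi / real n)"
      using n by (intro cos_gt_zero_pi) (auto simp: divide_simps intro: less_le_trans[of _ 0])
    then show False using assms(2) by (simp add: cox_coeff_def enat)
  qed
  then have "n = 2" using n by auto
  then show ?thesis by (simp add: enat numeral_eq_enat)
qed (use assms in \<open>simp add: cox_coeff_def\<close>)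

lemma dual_refl_involution:
  assumes "m a a = 1"
  shows "dual_refl m a (dual_refl m a f) = f"
  by (simp add: dual_refl_def cox_coeff_self[of m a, OF assms] algebra_simps)

text \<open>
  Multiplied by \<open>2 sin \<theta>\<close>, the sum telescopes to a difference of two cosines whose arguments
  differ by a full turn.
\<close>

lemma sum_sin_full_turn:
  fixes n :: nat and \<beta> :: real
  assumes "2 \<le> n"
  defines "\<theta> \<equiv> pi / real n"
  shows "(\<Sum>j<n. sin (2 * real j * \<theta> + \<beta>)) = 0"
proof -
  have s: "sin \<theta> \<noteq> 0"
    using assms sin_gt_zero[of \<theta>] by (auto simp: \<theta>_def divide_simps)
  have "2 * sin \<theta> * sin (2 * real j * \<theta> + \<beta>)
      = cos (2 * real j * \<theta> + \<beta> - \<theta>) - cos (2 * real (Suc j) * \<theta> + \<beta> - \<theta>)" for j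
  proof -
    have "2 * real (Suc j) * \<theta> + \<beta> - \<theta> = 2 * real j * \<theta> + \<beta> + \<theta>"
      by (simp add: algebra_simps)
    then show ?thesis
      by (simp only: cos_add cos_diff) (simp add: algebra_simps)
  qed
  then have "2 * sin \<theta> * (\<Sum>j<n. sin (2 * real j * \<theta> + \<beta>))
      = (\<Sum>j<n. cos (2 * real j * \<theta> + \<beta> - \<theta>) - cos (2 * real (Suc j) * \<theta> + \<beta> - \<theta>))"
    by (simp add: sum_distrib_left)
  also have "\<dots> = cos (\<beta> - \<theta>) - cos (2 * real n * \<theta> + \<beta> - \<theta>)"
    by (subst sum_lessThan_telescope') simp
  also have "2 * real n * \<theta> + \<beta> - \<theta> = (\<beta> - \<theta>) + 2 * pi"
    using assms by (simp add: \<theta>_def)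
  also have "cos (\<beta> - \<theta>) - cos ((\<beta> - \<theta>) + 2 * pi) = 0"
    by simp
  finally show ?thesis using s by simp
qed

text \<open>
  Each of the \<open>2 n\<close> reflections adds to the value at \<open>r\<close> a fixed coefficient times the current
  value at the reflecting generator.  So it suffices that the multipliers \<open>y\<close> at \<open>b\<close> sum to zero,
  and likewise the multipliers \<open>v\<close> at \<open>a\<close>.  Taken alternately, the multipliers satisfy
  \<open>z\<^sub>i\<^sub>+\<^sub>2 = 2 cos \<theta> z\<^sub>i\<^sub>+\<^sub>1 - z\<^sub>i\<close>; hence they are combinations of sines of multiples of
  \<open>\<theta> = \<pi> / n\<close>, and every second one runs over a full turn.
\<close>

lemma dual_refl_braid:
  assumes aa: "m a a = 1" and bb: "m b b = 1"
    and ab: "m a b = enat n" and ba: "m b a = enat n" and n: "2 \<le> n"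
  shows "((dual_refl m a \<circ> dual_refl m b) ^^ n) f = f"
proof -
  define \<theta> where "\<theta> = pi / real n"
  define c where "c = 2 * cos \<theta>"
  define F where "F j = ((dual_refl m a \<circ> dual_refl m b) ^^ j) f" for j
  define y where "y j = F j b" for j
  define v where "v j = F j a + c * F j b" for j
  have cab: "cox_coeff m a b = c" "cox_coeff m b a = c" "cox_coeff m a a = -2" "cox_coeff m b b = -2"
    using ab ba aa bb by (simp_all add: cox_coeff_def c_def \<theta>_def one_enat_def)
  have F_Suc: "F (Suc j) r = F j r + cox_coeff m r b * y j + cox_coeff m r a * v j" for j r
    by (simp add: F_def y_def v_def dual_refl_def cab algebra_simps)
  have F_sum: "F j r = f r + cox_coeff m r b * (\<Sum>i<j. y i) + cox_coeff m r a * (\<Sum>i<j. v i)" for j r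
    by (induction j) (simp_all add: F_Suc algebra_simps, simp add: F_def)
  have y_Suc: "y (Suc j) = c * v j - y j" for j
    by (simp add: y_def F_Suc cab)
  have v_Suc: "v (Suc j) = c * y (Suc j) - v j" for j
    by (simp add: v_def F_Suc cab y_def[symmetric])
  have rec: "c * sin \<alpha> - sin (\<alpha> - \<theta>) = sin (\<alpha> + \<theta>)" for \<alpha>
    by (simp add: sin_add sin_diff c_def)
  have closed: "y j * sin \<theta> = v 0 * sin (2 * real j * \<theta>) - y 0 * sin (2 * real j * \<theta> - \<theta>) \<and>
      v j * sin \<theta> = v 0 * sin (2 * real j * \<theta> + \<theta>) - y 0 * sin (2 * real j * \<theta>)" for j
  proof (induction j)
    case (Suc j)
    define \<alpha> where "\<alpha> = 2 * real j * \<theta> + \<theta>"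
    have \<alpha>: "2 * real j * \<theta> = \<alpha> - \<theta>" "2 * real (Suc j) * \<theta> = \<alpha> + \<theta>"
      by (simp_all add: \<alpha>_def algebra_simps)
    have IH: "y j * sin \<theta> = v 0 * sin (\<alpha> - \<theta>) - y 0 * sin (\<alpha> - \<theta> - \<theta>)"
      "v j * sin \<theta> = v 0 * sin \<alpha> - y 0 * sin (\<alpha> - \<theta>)"
      using Suc unfolding \<alpha> by simp_all
    have "y (Suc j) * sin \<theta> = c * (v j * sin \<theta>) - y j * sin \<theta>"
      by (simp add: y_Suc algebra_simps)
    also have "\<dots> = v 0 * (c * sin \<alpha> - sin (\<alpha> - \<theta>)) - y 0 * (c * sin (\<alpha> - \<theta>) - sin (\<alpha> - \<theta> - \<theta>))"
      unfolding IH by (simp add: algebra_simps)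
    finally have y: "y (Suc j) * sin \<theta> = v 0 * sin (\<alpha> + \<theta>) - y 0 * sin \<alpha>"
      by (simp only: rec diff_add_cancel)
    have "v (Suc j) * sin \<theta> = c * (y (Suc j) * sin \<theta>) - v j * sin \<theta>"
      by (simp add: v_Suc algebra_simps)
    also have "\<dots> = v 0 * (c * sin (\<alpha> + \<theta>) - sin (\<alpha> + \<theta> - \<theta>)) - y 0 * (c * sin \<alpha> - sin (\<alpha> - \<theta>))"
      unfolding IH y by (simp add: algebra_simps)
    finally have "v (Suc j) * sin \<theta> = v 0 * sin (\<alpha> + \<theta> + \<theta>) - y 0 * sin (\<alpha> + \<theta>)"
      by (simp only: rec)
    with y show ?case unfolding \<alpha> by simp
  qed simp
  have "sin \<theta> \<noteq> 0"
    using n sin_gt_zero[of \<theta>] by (auto simp: \<theta>_def divide_simps)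
  note z = sum_sin_full_turn[OF n, folded \<theta>_def]
  have "(\<Sum>j<n. y j) * sin \<theta> = v 0 * (\<Sum>j<n. sin (2 * real j * \<theta> + 0)) - y 0 * (\<Sum>j<n. sin (2 * real j * \<theta> + - \<theta>))"
    using closed by (simp add: sum_distrib_right sum_distrib_left sum_subtractf)
  then have "(\<Sum>j<n. y j) = 0"
    using \<open>sin \<theta> \<noteq> 0\<close> unfolding z by simp
  moreover have "(\<Sum>j<n. v j) * sin \<theta> = v 0 * (\<Sum>j<n. sin (2 * real j * \<theta> + \<theta>)) - y 0 * (\<Sum>j<n. sin (2 * real j * \<theta> + 0))"
    using closed by (simp add: sum_distrib_right sum_distrib_left sum_subtractf)
  then have "(\<Sum>j<n. v j) = 0"
    using \<open>sin \<theta> \<noteq> 0\<close> unfolding z by simp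
  ultimately have "F n r = f r" for r
    by (simp add: F_sum)
  then show ?thesis by (simp add: F_def fun_eq_iff)
qed

lemma dual_act_relator:
  "dual_act m (concat (replicate n [(a, True), (b, True)])) = (dual_refl m a \<circ> dual_refl m b) ^^ n"
proof (induction n)
  case (Suc n)
  then have IH: "dual_act m (concat (replicate n [(a, True), (b, True)])) f
      = ((dual_refl m a \<circ> dual_refl m b) ^^ n) f" for f
    by (simp only:)
  show ?case
    by (rule ext) (simp add: IH o_def)
qed (simp add: fun_eq_iff)

text \<open>
  The relators act trivially, so the action factors through the Coxeter group.
\<close>

lemma dual_act_pres_cong:
  assumes m: "coxeter_matrix S m" and uv: "pres_cong S (coxeter_relators S m) u v"
  shows "dual_act m u = dual_act m v"
  using uv
proof induction
  case (cancel a b)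
  then show ?case
    using m dual_refl_involution[of m a] by (auto simp: coxeter_matrix_def fun_eq_iff)
next
  case (relator r)
  then obtain a b n where r: "r = concat (replicate n [(a, True), (b, True)])"
    and ab: "a \<in> S" "b \<in> S" "m a b = enat n"
    by (auto simp: coxeter_relators_def)
  have one: "m a a = 1" "m b b = 1" and ba: "m b a = enat n"
    using m ab by (auto simp: coxeter_matrix_def)
  show ?case
  proof (cases "a = b")
    case True
    then have "n = 1" using one ab by (simp add: one_enat_def)
    then show ?thesis
      using True dual_refl_involution[of m a, OF one(1)] by (simp add: r fun_eq_iff)
  next
    case False
    then have "2 \<le> m a b" using m ab(1,2) unfolding coxeter_matrix_def by blast
    then have "2 \<le> n" by (simp add: ab numeral_eq_enat)
    then show ?thesis
      using dual_refl_braid[of m a b n] one ab ba by (simp add: r dual_act_relator fun_eq_iff)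
  qed
next
  case (append u u' v v')
  then show ?case by (intro ext) simp
qed auto

section \<open>Words in the generators\<close>

text \<open>
  Equality in the Coxeter group, for words without formal inverses: the moments only involve
  products of generators.
\<close>

definition cox_word_eq :: "'a set \<Rightarrow> ('a \<Rightarrow> 'a \<Rightarrow> enat) \<Rightarrow> 'a list \<Rightarrow> 'a list \<Rightarrow> bool" where
  "cox_word_eq S m u v \<longleftrightarrow>
     pres_cong S (coxeter_relators S m) (map (\<lambda>a. (a, True)) u) (map (\<lambda>a. (a, True)) v)"

lemma map_True_words [simp]: "map (\<lambda>a. (a, True)) u \<in> words_over S \<longleftrightarrow> set u \<subseteq> S"
  by (auto simp: words_over_def)

lemma cox_word_eq_refl [simp]: "set u \<subseteq> S \<Longrightarrow> cox_word_eq S m u u"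
  by (simp add: cox_word_eq_def pres_cong.refl)

lemma cox_word_eq_sym: "cox_word_eq S m u v \<Longrightarrow> cox_word_eq S m v u"
  unfolding cox_word_eq_def by (rule pres_cong.sym)

lemma cox_word_eq_trans [trans]:
  "cox_word_eq S m u v \<Longrightarrow> cox_word_eq S m v w \<Longrightarrow> cox_word_eq S m u w"
  unfolding cox_word_eq_def by (rule pres_cong.trans)

lemma cox_word_eq_append:
  "cox_word_eq S m u u' \<Longrightarrow> cox_word_eq S m v v' \<Longrightarrow> cox_word_eq S m (u @ v) (u' @ v')"
  unfolding cox_word_eq_def by (simp add: pres_cong.append)

lemma cox_word_eq_context:
  assumes "cox_word_eq S m u v" "set x \<subseteq> S" "set y \<subseteq> S"
  shows "cox_word_eq S m (x @ u @ y) (x @ v @ y)"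
  using assms by (intro cox_word_eq_append) auto

lemma cox_word_eq_subset: "cox_word_eq S m u v \<Longrightarrow> set u \<subseteq> S \<and> set v \<subseteq> S"
  unfolding cox_word_eq_def by (drule pres_cong_words) simp

lemma cox_word_eq_relator:
  assumes "a \<in> S" "b \<in> S" "m a b = enat n"
  shows "cox_word_eq S m (concat (replicate n [a, b])) []"
proof -
  have eq: "map (\<lambda>a. (a, True)) (concat (replicate n [a, b])) = concat (replicate n [(a, True), (b, True)])"
    by (simp add: map_concat)
  have "set (concat (replicate n [a, b])) \<subseteq> S"
    using assms by auto
  then have "map (\<lambda>a. (a, True)) (concat (replicate n [a, b])) \<in> words_over S"
    by (simp only: map_True_words)
  then show ?thesis
    unfolding cox_word_eq_def eq using assms
    by (auto intro!: pres_cong.relator simp: coxeter_relators_def)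
qed

lemma cox_word_eq_square:
  assumes "coxeter_matrix S m" "a \<in> S"
  shows "cox_word_eq S m [a, a] []"
  using cox_word_eq_relator[of a S a m 1] assms by (simp add: coxeter_matrix_def one_enat_def)

text \<open>
  The word \<open>b a\<close> equals \<open>b a (a b a b)\<close>, in which the two squares cancel and leave \<open>a b\<close>.
\<close>

lemma cox_word_eq_commute:
  assumes m: "coxeter_matrix S m" and ab: "a \<in> S" "b \<in> S" "m a b = 2"
  shows "cox_word_eq S m [a, b] [b, a]"
proof -
  note ctx = cox_word_eq_context[of S m]
  have "cox_word_eq S m [a, b, a, b] []"
    using cox_word_eq_relator[of a S b m 2] ab by (simp add: numeral_eq_enat numeral_2_eq_2)
  then have 1: "cox_word_eq S m ([b, a] @ [a, b, a, b] @ []) ([b, a] @ [] @ [])"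
    using ab by (intro ctx) auto
  have "cox_word_eq S m ([b] @ [a, a] @ [b, a, b]) ([b] @ [] @ [b, a, b])"
    using ab m by (intro ctx cox_word_eq_square) auto
  also have "cox_word_eq S m ([b] @ [] @ [b, a, b]) ([] @ [] @ [a, b])"
    using ab m cox_word_eq_context[OF cox_word_eq_square[OF m ab(2)], of "[]" "[a, b]"] by simp
  finally show ?thesis
    using 1 cox_word_eq_sym cox_word_eq_trans by fastforce
qed

lemma cox_word_eq_commute_list:
  assumes m: "coxeter_matrix S m" and s: "s \<in> S" and u: "set u \<subseteq> S" "\<forall>t\<in>set u. m s t = 2"
  shows "cox_word_eq S m (s # u) (u @ [s])"
  using u
proof (induction u)
  case (Cons t u)
  have "cox_word_eq S m ([] @ [s, t] @ u) ([] @ [t, s] @ u)"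
    using Cons.prems s m by (intro cox_word_eq_context cox_word_eq_commute) auto
  also have "cox_word_eq S m ([] @ [t, s] @ u) ([t] @ (u @ [s]) @ [])"
    using cox_word_eq_context[OF Cons.IH, of "[t]" "[]"] Cons.prems by simp
  finally show ?case by simp
qed (use s in simp)

text \<open>
  The first \<open>s\<close> moves past \<open>u\<close> and cancels against the second.
\<close>

lemma cox_word_eq_remove_pair:
  assumes m: "coxeter_matrix S m" and s: "s \<in> S" and sub: "set x \<subseteq> S" "set u \<subseteq> S" "set y \<subseteq> S"
    and comm: "\<forall>t\<in>set u. m s t = 2"
  shows "cox_word_eq S m (x @ s # u @ s # y) (x @ u @ y)"
proof -
  have "cox_word_eq S m (x @ (s # u) @ (s # y)) (x @ (u @ [s]) @ (s # y))"
    using assms by (intro cox_word_eq_context cox_word_eq_commute_list) auto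
  also have "cox_word_eq S m (x @ (u @ [s]) @ (s # y)) (x @ u @ y)"
    using cox_word_eq_context[OF cox_word_eq_square[OF m s], of "x @ u" y] sub by simp
  finally show ?thesis by simp
qed

abbreviation dual_act_pos :: "('a \<Rightarrow> 'a \<Rightarrow> enat) \<Rightarrow> 'a list \<Rightarrow> ('a \<Rightarrow> real) \<Rightarrow> 'a \<Rightarrow> real" where
  "dual_act_pos m w \<equiv> dual_act m (map (\<lambda>a. (a, True)) w)"

lemma dual_act_cox_word_eq:
  "coxeter_matrix S m \<Longrightarrow> cox_word_eq S m u v \<Longrightarrow> dual_act_pos m u = dual_act_pos m v"
  unfolding cox_word_eq_def by (rule dual_act_pres_cong)

text \<open>
  The parabolic subgroup generated by zeros of \<open>f\<close> fixes \<open>f\<close>.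
\<close>

lemma dual_act_fixed:
  assumes "\<forall>t\<in>set w. f t = 0"
  shows "dual_act_pos m w f = f"
  using assms by (induction w) (auto simp: dual_refl_def)

lemma dual_act_rev:
  assumes "coxeter_matrix S m" "set w \<subseteq> S"
  shows "dual_act_pos m (rev w) (dual_act_pos m w f) = f"
  using assms(2)
proof (induction w arbitrary: f)
  case (Cons a w)
  have "m a a = 1" using assms(1) Cons.prems by (auto simp: coxeter_matrix_def)
  then show ?case using Cons dual_refl_involution[of m a] by simp
qed simp

text \<open>
  In the group \<open>v\<close> is the inverse of \<open>y x\<close>, which fixes \<open>f\<close>.
\<close>

lemma trivial_conjugate:
  assumes m: "coxeter_matrix S m" and triv: "cox_word_eq S m (x @ v @ y) []"
    and f: "\<forall>t\<in>set x \<union> set y. f t = 0"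
  shows "dual_act_pos m v f = f"
proof -
  have x: "set x \<subseteq> S"
    using cox_word_eq_subset[OF triv] by simp
  have "dual_act_pos m x (dual_act_pos m v f) = f"
    using fun_cong[OF dual_act_cox_word_eq[OF m triv], of f] dual_act_fixed[of y f m] f by simp
  then have "dual_act_pos m v f = dual_act_pos m (rev x) f"
    using dual_act_rev[OF m x, of "dual_act_pos m v f"] by simp
  also have "\<dots> = f"
    using f by (intro dual_act_fixed) auto
  finally show ?thesis .
qed

text \<open>
  If \<open>s\<close> occurred once, all other letters would fix the indicator function of \<open>s\<close>, and then so
  would \<open>s\<close>; but \<open>s\<close> negates its value at \<open>s\<close>.
\<close>

lemma trivial_no_single_letter:
  assumes m: "coxeter_matrix S m" and triv: "cox_word_eq S m w []"
  shows "count_list w s \<noteq> 1"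
proof
  assume 1: "count_list w s = 1"
  then have "s \<in> set w" by (metis count_notin zero_neq_one)
  then obtain x y where w: "w = x @ s # y" by (meson split_list)
  have xy: "s \<notin> set x" "s \<notin> set y"
    using 1 by (auto simp: w count_list_0_iff)
  have s: "m s s = 1"
    using cox_word_eq_subset[OF triv] m by (auto simp: w coxeter_matrix_def)
  define f where "f = (\<lambda>t. if t = s then 1 else 0 :: real)"
  have "dual_act_pos m [s] f = f"
    using xy triv by (intro trivial_conjugate[OF m, of x _ y]) (auto simp: f_def w)
  then have "dual_refl m s f s = f s" by simp
  then show False
    using cox_coeff_self[of m s, OF s] by (simp add: dual_refl_def f_def)
qed

text \<open>
  Off the diagonal the coefficients are nonnegative, so a reflection in a letter with nonnegative
  value can only raise the values elsewhere.  Since the letters are distinct, each acts before its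
  own value has been negated, with a value that is at least the initial one.
\<close>

lemma dual_act_pos_increases:
  assumes m: "coxeter_matrix S m" and "set u \<subseteq> S" "distinct u" "r \<in> S" "r \<notin> set u"
    and "\<forall>t\<in>set u. 0 \<le> g t"
  shows "g r \<le> dual_act_pos m u g r \<and> (t \<in> set u \<longrightarrow> g r + cox_coeff m r t * g t \<le> dual_act_pos m u g r)"
  using assms(2-)
proof (induction u arbitrary: r t)
  case (Cons a u)
  let ?h = "dual_act_pos m u g"
  have pos: "0 \<le> cox_coeff m r a"
    using m Cons.prems by (intro cox_coeff_nonneg) (auto simp: coxeter_matrix_def)
  have IHr: "g r \<le> ?h r" "t \<in> set u \<Longrightarrow> g r + cox_coeff m r t * g t \<le> ?h r"
    using Cons.IH[of r t] Cons.prems by auto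
  have a: "g a \<le> ?h a" "0 \<le> g a"
    using Cons.IH[of a t] Cons.prems by auto
  have "cox_coeff m r a * g a \<le> cox_coeff m r a * ?h a" "0 \<le> cox_coeff m r a * ?h a"
    using a pos by (auto intro: mult_left_mono)
  then show ?case
    using IHr by (auto simp: dual_refl_def)
qed simp

text \<open>
  The indicator function \<open>f\<close> of \<open>s\<close> is fixed by \<open>x\<close> and \<open>y\<close>, hence by \<open>s u s\<close>, so \<open>u\<close> fixes the
  reflected function \<open>g\<close>.  Outside \<open>s\<close> the values of \<open>g\<close> are the nonnegative coefficients.  Every
  letter \<open>t\<close> of \<open>u\<close> raises the value at \<open>s\<close> by at least the square of the coefficient of \<open>s\<close> and
  \<open>t\<close>, and the total increase is zero.
\<close>

lemma trivial_imp_commute: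
  assumes m: "coxeter_matrix S m" and triv: "cox_word_eq S m (x @ s # u @ s # y) []"
    and s: "s \<notin> set x" "s \<notin> set u" "s \<notin> set y" and u: "distinct u" and t: "t \<in> set u"
  shows "m s t = 2"
proof -
  have S: "set u \<subseteq> S" "s \<in> S" "t \<in> S"
    using cox_word_eq_subset[OF triv] t by auto
  have neq: "t \<noteq> s" using s t by auto
  have mss: "m s s = 1" using m S by (simp add: coxeter_matrix_def)
  define f where "f = (\<lambda>r. if r = s then 1 else 0 :: real)"
  define g where "g = dual_refl m s f"
  have g: "g r = (if r = s then -1 else cox_coeff m r s)" for r
    using cox_coeff_self[of m s, OF mss] by (simp add: g_def f_def dual_refl_def)
  have "dual_act_pos m (s # u @ [s]) f = f"
    using triv s by (intro trivial_conjugate[OF m, of x _ y]) (auto simp: f_def)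
  then have "dual_refl m s (dual_act_pos m u g) = f"
    by (simp add: g_def)
  then have "dual_refl m s (dual_refl m s (dual_act_pos m u g)) = g"
    by (simp only: g_def)
  then have ug: "dual_act_pos m u g = g"
    by (simp only: dual_refl_involution[of m s, OF mss])
  have "\<forall>r\<in>set u. 0 \<le> g r"
    using m S s by (auto simp: g coxeter_matrix_def intro!: cox_coeff_nonneg)
  from dual_act_pos_increases[OF m S(1) u S(2) s(2) this, of t]
  have "cox_coeff m s t * g t \<le> 0" unfolding ug using t by simp
  then have le: "cox_coeff m s t * cox_coeff m t s \<le> 0" using neq by (simp add: g)
  have ge2: "2 \<le> m s t" and sym: "m t s = m s t"
    using m S neq by (auto simp: coxeter_matrix_def)
  then have "cox_coeff m t s = cox_coeff m s t" by (simp add: cox_coeff_def)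
  with le have "cox_coeff m s t = 0" by (auto simp: mult_le_0_iff)
  with ge2 show ?thesis by (rule cox_coeff_eq_0)
qed


section \<open>Words in which every letter occurs twice\<close>

text \<open>
  If \<open>a\<close> and \<open>b\<close> occur exactly twice, this says that their pairs of positions cross and that \<open>a\<close>
  comes first.
\<close>

definition interlaced :: "'a list \<Rightarrow> 'a \<Rightarrow> 'a \<Rightarrow> bool" where
  "interlaced w a b \<longleftrightarrow> a \<noteq> b \<and> subseq [a, b, a, b] w"

definition pair_word :: "'a list \<Rightarrow> bool" where
  "pair_word w \<longleftrightarrow> (\<forall>a\<in>set w. count_list w a = 2)"

lemma ex_shortest_repeat:
  "\<not> distinct w \<Longrightarrow> \<exists>x s u y. w = x @ s # u @ s # y \<and> distinct u \<and> s \<notin> set u"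
proof (induction w)
  case (Cons a w)
  show ?case
  proof (cases "distinct w")
    case True
    with Cons.prems have "a \<in> set w" by simp
    then obtain u y where "w = u @ a # y" "a \<notin> set u" by (meson split_list_first)
    with True show ?thesis by (intro exI[of _ "[]"]) auto
  next
    case False
    with Cons.IH obtain x s u y where "w = x @ s # u @ s # y" "distinct u" "s \<notin> set u" by blast
    then show ?thesis by (intro exI[of _ "a # x"]) auto
  qed
qed simp

lemma distinct_count_list_le_1: "distinct w \<Longrightarrow> count_list w a \<le> 1"
  by (induction w) auto

lemma interlaced_decompose:
  assumes "interlaced w a b"
  obtains w0 w1 w2 w3 w4 where "w = w0 @ a # w1 @ b # w2 @ a # w3 @ b # w4"
proof -
  have cons: "\<exists>us vs. ys = us @ c # vs \<and> subseq zs vs" if "subseq (c # zs) ys" for c zs and ys :: "'a list"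
    using list_emb_ConsD[OF that] by simp
  have "subseq [a, b, a, b] w"
    using assms by (simp add: interlaced_def)
  then obtain w0 v0 where 0: "w = w0 @ a # v0" "subseq [b, a, b] v0"
    by (blast dest!: cons)
  from cons[OF 0(2)] obtain w1 v1 where 1: "v0 = w1 @ b # v1" "subseq [a, b] v1"
    by blast
  from cons[OF 1(2)] obtain w2 v2 where 2: "v1 = w2 @ a # v2" "subseq [b] v2"
    by blast
  from cons[OF 2(2)] obtain w3 v3 where 3: "v2 = w3 @ b # v3"
    by blast
  show thesis
    by (rule that) (simp add: 0(1) 1(1) 2(1) 3)
qed

lemma interlaced_letters:
  assumes "interlaced w a b"
  shows "a \<in> set w \<and> b \<in> set w \<and> a \<noteq> b"
proof -
  obtain w0 w1 w2 w3 w4 where "w = w0 @ a # w1 @ b # w2 @ a # w3 @ b # w4"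
    using interlaced_decompose[OF assms] .
  then show ?thesis using assms by (simp add: interlaced_def)
qed

text \<open>
  Induction on the length, removing the letter \<open>s\<close> of a shortest repetition \<open>s u s\<close>.  The second
  occurrence of each letter of \<open>u\<close> lies outside, so the letters of \<open>u\<close> are exactly those that
  interlace with \<open>s\<close>.  If the word is trivial, they commute with \<open>s\<close> by \<open>trivial_imp_commute\<close>; if all
  interlaced letters commute, they do so by assumption.  In both cases removing \<open>s\<close> changes neither
  the group element nor the interlacing of the other letters.
\<close>

lemma trivial_pair_word_iff:
  assumes m: "coxeter_matrix S m" and "set w \<subseteq> S" "pair_word w"
  shows "cox_word_eq S m w [] \<longleftrightarrow> (\<forall>a b. interlaced w a b \<longrightarrow> m a b = 2)"
  using assms(2,3)
proof (induction "length w" arbitrary: w rule: less_induct)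
  case less
  show ?case
  proof (cases "distinct w")
    case True
    have "w = []"
    proof (rule ccontr)
      assume "w \<noteq> []"
      then have "hd w \<in> set w" by simp
      then have "count_list w (hd w) = 2" using less.prems by (simp add: pair_word_def)
      with distinct_count_list_le_1[OF True, of "hd w"] show False by simp
    qed
    then show ?thesis by (simp add: interlaced_def)
  next
    case False
    then obtain x s u y where w: "w = x @ s # u @ s # y" and u: "distinct u" and su: "s \<notin> set u"
      using ex_shortest_repeat by blast
    let ?w' = "x @ u @ y"
    have S: "s \<in> S" "set x \<subseteq> S" "set u \<subseteq> S" "set y \<subseteq> S"
      using less.prems by (auto simp: w)
    have "count_list w s = 2" using less.prems by (simp add: w pair_word_def)
    then have s: "s \<notin> set x" "s \<notin> set y"
      by (auto simp: w count_list_0_iff)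
    have "pair_word ?w'"
      unfolding pair_word_def
    proof
      fix a assume a: "a \<in> set ?w'"
      then have "count_list w a = 2" using less.prems(2) by (auto simp: pair_word_def w)
      moreover have "a \<noteq> s" using a s su by auto
      ultimately show "count_list ?w' a = 2" by (simp add: w)
    qed
    then have IH: "cox_word_eq S m ?w' [] \<longleftrightarrow> (\<forall>a b. interlaced ?w' a b \<longrightarrow> m a b = 2)"
      using S by (intro less.hyps) (auto simp: w)
    have w'_filter: "?w' = filter (\<lambda>c. c \<noteq> s) w"
    proof -
      have "filter (\<lambda>c. c \<noteq> s) z = z" if "s \<notin> set z" for z
        using that by (auto simp: filter_id_conv)
      then show ?thesis using s su by (simp add: w)
    qed
    have int_w': "interlaced ?w' a b \<longleftrightarrow> interlaced w a b" if "a \<noteq> s" "b \<noteq> s" for a b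
    proof -
      have "subseq (filter (\<lambda>c. c \<noteq> s) [a, b, a, b]) ?w'" if "subseq [a, b, a, b] w"
        using that unfolding w'_filter by (rule subseq_filter)
      moreover have "subseq ?w' w" unfolding w'_filter by simp
      ultimately show ?thesis
        using that unfolding interlaced_def by (auto intro: subseq_order.trans)
    qed
    have reduce: "cox_word_eq S m w [] \<longleftrightarrow> cox_word_eq S m ?w' []" if "\<forall>t\<in>set u. m s t = 2"
      using cox_word_eq_remove_pair[OF m S(1,2,3,4) that] unfolding w
      by (blast intro: cox_word_eq_sym cox_word_eq_trans)
    have sym: "m a s = m s a" if "a \<in> set w" for a
      using m S that less.prems by (auto simp: coxeter_matrix_def)
    have outer: "interlaced w s t \<or> interlaced w t s" if t: "t \<in> set u" for t
    proof -
      have "count_list u t \<le> 1" using u by (rule distinct_count_list_le_1)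
      moreover have "count_list w t = 2" using less.prems t by (simp add: w pair_word_def)
      moreover have "s \<noteq> t" using t su by auto
      ultimately have "t \<in> set x \<or> t \<in> set y"
        by (cases "t \<in> set x"; cases "t \<in> set y") (auto simp: w)
      then show ?thesis
      proof
        assume "t \<in> set x"
        then have "subseq ([t] @ [s] @ [t] @ [s] @ []) (x @ [s] @ u @ [s] @ y)"
          using t by (intro list_emb_append_mono) (auto simp: subseq_singleton_left)
        then show ?thesis using t su by (auto simp: interlaced_def w)
      next
        assume "t \<in> set y"
        then have "subseq ([] @ [s] @ [t] @ [s] @ [t]) (x @ [s] @ u @ [s] @ y)"
          using t by (intro list_emb_append_mono) (auto simp: subseq_singleton_left)
        then show ?thesis using t su by (auto simp: interlaced_def w)
      qed
    qed
    \<comment> \<open>Were \<open>t\<close> not in \<open>u\<close>, the two \<open>s\<close> would be adjacent among the occurrences of \<open>s\<close> and \<open>t\<close>.\<close>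
    have inner: "t \<in> set u" if t: "interlaced w s t \<or> interlaced w t s" for t
    proof (rule ccontr)
      assume tu: "t \<notin> set u"
      let ?P = "\<lambda>c. c = s \<or> c = t"
      have ts: "t \<noteq> s" "t \<in> set w" using t by (auto dest: interlaced_letters)
      have fx: "filter ?P z = replicate (count_list z t) t" if "s \<notin> set z" for z
        using that by (induction z) auto
      have fw: "filter ?P w = replicate (count_list x t) t @ [s, s] @ replicate (count_list y t) t"
        using fx[OF s(1)] fx[OF s(2)] fx[OF su] tu by (simp add: w)
      have "count_list w t = 2" using less.prems ts by (simp add: pair_word_def)
      then have "count_list x t + count_list y t = 2"
        using tu ts by (simp add: w)
      then have "(count_list x t = 0 \<and> count_list y t = 2) \<or> (count_list x t = 1 \<and> count_list y t = 1)
          \<or> (count_list x t = 2 \<and> count_list y t = 0)" by linarith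
      then have "filter ?P w = [s, s, t, t] \<or> filter ?P w = [t, s, s, t] \<or> filter ?P w = [t, t, s, s]"
        using fw by (auto simp: numeral_2_eq_2)
      moreover have "subseq (filter ?P [s, t, s, t]) (filter ?P w) \<or> subseq (filter ?P [t, s, t, s]) (filter ?P w)"
        using t unfolding interlaced_def by (meson subseq_filter)
      ultimately show False using ts by auto
    qed
    show ?thesis
    proof
      assume triv: "cox_word_eq S m w []"
      then have comm: "\<forall>t\<in>set u. m s t = 2"
        using trivial_imp_commute[OF m triv[unfolded w] s(1) su s(2) u] by blast
      show "\<forall>a b. interlaced w a b \<longrightarrow> m a b = 2"
      proof (intro allI impI)
        fix a b assume ab: "interlaced w a b"
        show "m a b = 2"
        proof (cases "a = s \<or> b = s")
          case True
          then show ?thesis using ab inner comm sym interlaced_letters[OF ab] by metis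
        next
          case False
          then show ?thesis using triv IH reduce[OF comm] int_w' ab by blast
        qed
      qed
    next
      assume comm: "\<forall>a b. interlaced w a b \<longrightarrow> m a b = 2"
      then have "\<forall>t\<in>set u. m s t = 2"
        using outer sym by (fastforce simp: w)
      moreover have "m a b = 2" if ab: "interlaced ?w' a b" for a b
      proof -
        have "a \<noteq> s" "b \<noteq> s" using interlaced_letters[OF ab] s su by auto
        then show ?thesis using int_w' comm ab by blast
      qed
      ultimately show "cox_word_eq S m w []"
        using IH reduce by blast
    qed
  qed
qed

section \<open>Words and pair-partitions\<close>

definition positions :: "'a list \<Rightarrow> 'a \<Rightarrow> nat set" where
  "positions l a = {q \<in> {1..length l}. l ! (q - 1) = a}"

text \<open>
  The partition of the positions by equality of letters.  Positions start at \<open>1\<close>, to match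
  \<^const>\<open>pair_partitions\<close>.
\<close>

definition word_kernel :: "'a list \<Rightarrow> nat set set" where
  "word_kernel l = positions l ` set l"

lemma finite_positions [simp]: "finite (positions l a)"
  by (simp add: positions_def)

lemma card_positions: "card (positions l a) = count_list l a"
proof -
  have "positions l a = Suc ` {i. i < length l \<and> a = l ! i}"
  proof (intro equalityI subsetI)
    fix q assume "q \<in> positions l a"
    then show "q \<in> Suc ` {i. i < length l \<and> a = l ! i}"
      by (intro image_eqI[of _ _ "q - 1"]) (auto simp: positions_def)
  qed (auto simp: positions_def)
  then show ?thesis
    by (simp add: card_image count_list_eq_length_filter length_filter_conv_card)
qed

lemma positions_nonempty: "a \<in> set l \<Longrightarrow> positions l a \<noteq> {}"
  by (metis card.empty card_positions count_list_0_iff)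

lemma inj_on_positions: "inj_on (positions l) (set l)"
  by (rule inj_onI) (use positions_nonempty in \<open>fastforce simp: positions_def\<close>)

lemma mem_positions_nth: "q \<in> {1..length l} \<Longrightarrow> q \<in> positions l (l ! (q - 1))"
  by (simp add: positions_def)

lemma partition_on_word_kernel: "partition_on {1..length l} (word_kernel l)"
proof (rule partition_onI)
  show "\<Union> (word_kernel l) = {1..length l}"
  proof (intro equalityI subsetI)
    fix q assume q: "q \<in> {1..length l}"
    then have "l ! (q - 1) \<in> set l" by (intro nth_mem) auto
    with mem_positions_nth[OF q] show "q \<in> \<Union> (word_kernel l)"
      by (auto simp: word_kernel_def)
  qed (auto simp: word_kernel_def positions_def)
  show "disjnt B C" if "B \<in> word_kernel l" "C \<in> word_kernel l" "B \<noteq> C" for B C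
    using that by (auto simp: word_kernel_def positions_def disjnt_def)
  show "{} \<notin> word_kernel l"
    using positions_nonempty[of _ l] by (auto simp: word_kernel_def)
qed

lemma pair_word_iff_word_kernel: "pair_word l \<longleftrightarrow> word_kernel l \<in> pair_partitions (length l)"
  using partition_on_word_kernel[of l] by (auto simp: pair_partitions_def pair_word_def word_kernel_def card_positions)

lemma card_set_pair_word: "pair_word l \<Longrightarrow> 2 * card (set l) = length l"
  using sum_count_set[of l "set l"] by (simp add: pair_word_def)

lemma subseq_drop_Cons:
  assumes "j \<le> i" "i < length l" "subseq xs (drop (Suc i) l)"
  shows "subseq (l ! i # xs) (drop j l)"
proof -
  have "drop j l = take (i - j) (drop j l) @ drop i l"
    using assms(1) by (metis append_take_drop_id drop_drop le_add_diff_inverse2)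
  moreover have "drop i l = l ! i # drop (Suc i) l"
    using assms(2) by (simp add: Cons_nth_drop_Suc)
  ultimately show ?thesis
    using assms(3) by (metis list_emb_append2 subseq_Cons2)
qed

text \<open>
  The right-hand side is the condition that defines an inversion, for the blocks of \<open>a\<close> and \<open>b\<close>.
\<close>

lemma interlaced_iff_positions:
  assumes l: "pair_word l" and a: "a \<in> set l" and b: "b \<in> set l"
  shows "interlaced l a b \<longleftrightarrow>
    Min (positions l a) < Min (positions l b) \<and> Min (positions l b) < Max (positions l a) \<and>
    Max (positions l a) < Max (positions l b)"
proof
  assume "interlaced l a b"
  then obtain w0 w1 w2 w3 w4 where w: "l = w0 @ a # w1 @ b # w2 @ a # w3 @ b # w4"
    by (rule interlaced_decompose)
  let ?e1 = "length w0 + 1" let ?e2 = "?e1 + length w1 + 1"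
  let ?f1 = "?e2 + length w2 + 1" let ?f2 = "?f1 + length w3 + 1"
  have two: "card (positions l a) = 2" "card (positions l b) = 2"
    using l a b by (simp_all add: card_positions pair_word_def)
  have "{?e1, ?f1} \<subseteq> positions l a" "{?e2, ?f2} \<subseteq> positions l b"
    by (auto simp: positions_def w nth_append)
  then have "{?e1, ?f1} = positions l a" "{?e2, ?f2} = positions l b"
    using two by (intro card_subset_eq; simp)+
  from this[symmetric] show "Min (positions l a) < Min (positions l b) \<and>
      Min (positions l b) < Max (positions l a) \<and> Max (positions l a) < Max (positions l b)"
    by simp
next
  assume less: "Min (positions l a) < Min (positions l b) \<and> Min (positions l b) < Max (positions l a) \<and>
    Max (positions l a) < Max (positions l b)"
  define e1 where "e1 = Min (positions l a) - 1"
  define e2 where "e2 = Min (positions l b) - 1"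
  define f1 where "f1 = Max (positions l a) - 1"
  define f2 where "f2 = Max (positions l b) - 1"
  have "Min (positions l a) \<in> positions l a" "Max (positions l a) \<in> positions l a"
    "Min (positions l b) \<in> positions l b" "Max (positions l b) \<in> positions l b"
    using a b by (simp_all add: positions_nonempty)
  moreover have "1 \<le> q \<and> q \<le> length l \<and> l ! (q - 1) = c" if "q \<in> positions l c" for q c
    using that by (simp add: positions_def)
  ultimately have *: "1 \<le> Min (positions l a)" "Max (positions l b) \<le> length l"
    and n: "l ! e1 = a" "l ! f1 = a" "l ! e2 = b" "l ! f2 = b"
    unfolding e1_def e2_def f1_def f2_def by blast+
  have o: "Suc e1 \<le> e2" "Suc e2 \<le> f1" "Suc f1 \<le> f2" "f2 < length l"
    using less * unfolding e1_def e2_def f1_def f2_def by linarith+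
  have "subseq [l ! e1, l ! e2, l ! f1, l ! f2] (drop 0 l)"
    using o by (intro subseq_drop_Cons) auto
  moreover have "a \<noteq> b" using less by auto
  ultimately show "interlaced l a b"
    by (simp add: interlaced_def n)
qed

text \<open>
  A block of the kernel determines the letter at its positions, so the numbering of the blocks gives
  a bijection \<open>\<phi>\<close> onto the letters that turns inversions into interlacing pairs.
\<close>

lemma card_inversions_word_kernel:
  assumes l: "pair_word l"
  shows "card (inversions (word_kernel l)) = card {(a, b). interlaced l a b}"
proof -
  let ?V = "word_kernel l"
  have pb: "bij_betw (pair_block ?V) {1..card ?V} ?V"
    using l pair_word_iff_word_kernel pair_block_bij by blast
  have pos: "bij_betw (positions l) (set l) ?V"
    using inj_on_positions by (simp add: bij_betw_def word_kernel_def)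
  define \<phi> where "\<phi> = the_inv_into (set l) (positions l) \<circ> pair_block ?V"
  have \<phi>: "bij_betw \<phi> {1..card ?V} (set l)"
    unfolding \<phi>_def by (rule bij_betw_trans[OF pb bij_betw_the_inv_into[OF pos]])
  have pos_\<phi>: "positions l (\<phi> i) = pair_block ?V i" if "i \<in> {1..card ?V}" for i
  proof -
    have "pair_block ?V i \<in> ?V" using pb that by (auto simp: bij_betw_def)
    then show ?thesis using f_the_inv_into_f_bij_betw[OF pos] by (simp add: \<phi>_def)
  qed
  have \<phi>_set: "\<phi> i \<in> set l" if "i \<in> {1..card ?V}" for i
    using \<phi> that by (auto simp: bij_betw_def)
  have inv: "inversions ?V = {(i, j). i \<in> {1..card ?V} \<and> j \<in> {1..card ?V} \<and> interlaced l (\<phi> i) (\<phi> j)}"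
    unfolding inversions_def
    by (intro Collect_cong) (clarsimp simp: interlaced_iff_positions[OF l \<phi>_set \<phi>_set] pos_\<phi>
        simp del: atLeastAtMost_iff cong: conj_cong)
  have "{(a, b). interlaced l a b} = map_prod \<phi> \<phi> ` inversions ?V"
  proof (intro equalityI subsetI)
    fix z assume "z \<in> {(a, b). interlaced l a b}"
    then obtain a b where z: "z = (a, b)" "interlaced l a b" by auto
    then obtain i j where "i \<in> {1..card ?V}" "j \<in> {1..card ?V}" "a = \<phi> i" "b = \<phi> j"
      using \<phi> interlaced_letters[OF z(2)] unfolding bij_betw_def by (metis imageE)
    then show "z \<in> map_prod \<phi> \<phi> ` inversions ?V"
      using z by (force simp: inv)
  qed (auto simp: inv)
  moreover have "inj_on (map_prod \<phi> \<phi>) (inversions ?V)"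
    using \<phi> unfolding bij_betw_def
    by (intro inj_on_subset[OF map_prod_inj_on[of \<phi> "{1..card ?V}" \<phi> "{1..card ?V}"]]) (auto simp: inv)
  ultimately show ?thesis
    by (simp add: card_image)
qed

lemma finite_pair_partitions: "finite (pair_partitions k)"
proof (rule finite_subset)
  show "pair_partitions k \<subseteq> Pow (Pow {1..k})"
    by (auto simp: pair_partitions_def partition_on_def)
qed simp

lemma card_pair_partition:
  assumes "V \<in> pair_partitions k"
  shows "finite V" "2 * card V = k"
proof -
  have V: "partition_on {1..k} V" "\<And>B. B \<in> V \<Longrightarrow> card B = 2"
    using assms by (auto simp: pair_partitions_def)
  show fin: "finite V" using finite_elements[OF _ V(1)] by simp
  have "card {1..k} = (\<Sum>B\<in>V. card B)"
    using V(1) by (subst product_partition) (auto simp: partition_on_def intro: finite_subset)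
  also have "\<dots> = 2 * card V" using V(2) by simp
  finally show "2 * card V = k" by simp
qed

text \<open>
  The function \<open>ix\<close> numbers the blocks of a partition.  A word with this kernel is the same as the
  list of its letters in the order of the block numbers, and these letters are distinct.
\<close>

lemma card_lists_kernel_of_labels:
  fixes k n :: nat and ix :: "nat \<Rightarrow> nat" and A :: "'a set"
  assumes ix: "ix ` {1..k} = {..<n}"
  shows "card {l. length l = k \<and> set l \<subseteq> A \<and> word_kernel l = (\<lambda>j. {q \<in> {1..k}. ix q = j}) ` {..<n}}
       = card {xs. length xs = n \<and> distinct xs \<and> set xs \<subseteq> A}"
proof -
  define V where "V = (\<lambda>j. {q \<in> {1..k}. ix q = j}) ` {..<n}"
  define build :: "'a list \<Rightarrow> 'a list" where "build xs = map (\<lambda>i. xs ! ix (Suc i)) [0..<k]" for xs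
  have ix_less: "ix q < n" if "q \<in> {1..k}" for q
    using ix that by blast
  have len: "length (build xs) = k" for xs by (simp add: build_def)
  have nth: "build xs ! (q - 1) = xs ! ix q" if "q \<in> {1..k}" for q xs
    using that by (auto simp: build_def)
  have "bij_betw build {xs. length xs = n \<and> distinct xs \<and> set xs \<subseteq> A}
      {l. length l = k \<and> set l \<subseteq> A \<and> word_kernel l = V}"
    unfolding bij_betw_def
  proof
    show "inj_on build {xs. length xs = n \<and> distinct xs \<and> set xs \<subseteq> A}"
    proof (rule inj_onI, clarify)
      fix xs ys assume eq: "build xs = build ys" and n: "n = length xs" "length ys = length xs"
      show "xs = ys"
      proof (rule nth_equalityI)
        fix j assume "j < length xs"
        then obtain q where q: "q \<in> {1..k}" "j = ix q" using ix n by blast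
        show "xs ! j = ys ! j"
          using nth[OF q(1), of xs] nth[OF q(1), of ys] eq q by simp
      qed (use n in simp)
    qed
    show "build ` {xs. length xs = n \<and> distinct xs \<and> set xs \<subseteq> A} = {l. length l = k \<and> set l \<subseteq> A \<and> word_kernel l = V}"
    proof (intro equalityI subsetI)
      fix l assume "l \<in> build ` {xs. length xs = n \<and> distinct xs \<and> set xs \<subseteq> A}"
      then obtain xs where xs: "length xs = n" "distinct xs" "set xs \<subseteq> A" and l: "l = build xs" by blast
      have "set l = (!) l ` {..<k}"
        using len[of xs] l by (simp add: set_conv_nth image_def) blast
      also have "{..<k} = (\<lambda>q. q - 1) ` {1..k}"
      proof (intro equalityI subsetI)
        fix i assume "i \<in> {..<k}"
        then show "i \<in> (\<lambda>q. q - 1) ` {1..k}" by (intro image_eqI[of _ _ "Suc i"]) auto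
      qed auto
      also have "(!) l ` (\<lambda>q. q - 1) ` {1..k} = (\<lambda>q. l ! (q - 1)) ` {1..k}"
        by (simp only: image_image)
      also have "\<dots> = (!) xs ` (ix ` {1..k})"
        unfolding image_image l by (rule image_cong[OF _ nth]) simp_all
      finally have set_l: "set l = (!) xs ` {..<n}" by (simp only: ix)
      have "positions l (xs ! j) = {q \<in> {1..k}. ix q = j}" if "j < n" for j
      proof -
        have "l ! (q - 1) = xs ! j \<longleftrightarrow> ix q = j" if "q \<in> {1..k}" for q
          using nth[OF that, of xs] ix_less[OF that] \<open>j < n\<close> xs(1,2) l
          by (simp add: nth_eq_iff_index_eq)
        then show ?thesis using len[of xs] unfolding positions_def l by blast
      qed
      then have "word_kernel l = V"
        unfolding word_kernel_def set_l V_def image_image by (intro image_cong) auto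
      then show "l \<in> {l. length l = k \<and> set l \<subseteq> A \<and> word_kernel l = V}"
      proof -
        have "set l \<subseteq> A" using xs(1,3) nth_mem[of _ xs] unfolding set_l by blast
        then show ?thesis using \<open>word_kernel l = V\<close> len[of xs] l by simp
      qed
    next
      fix l assume "l \<in> {l. length l = k \<and> set l \<subseteq> A \<and> word_kernel l = V}"
      then have l: "length l = k" "set l \<subseteq> A" "word_kernel l = V" by auto
      have same: "l ! (q - 1) = l ! (q' - 1) \<longleftrightarrow> ix q = ix q'" if q: "q \<in> {1..k}" "q' \<in> {1..k}" for q q'
      proof -
        have mem: "l ! (q - 1) \<in> set l" using q(1) l(1) by (intro nth_mem) auto
        have "l ! (q - 1) = l ! (q' - 1) \<longleftrightarrow> (\<exists>a\<in>set l. q \<in> positions l a \<and> q' \<in> positions l a)"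
          using q mem by (simp add: positions_def l(1)) metis
        also have "\<dots> \<longleftrightarrow> (\<exists>B\<in>V. q \<in> B \<and> q' \<in> B)"
          unfolding l(3)[symmetric] word_kernel_def by blast
        also have "\<dots> \<longleftrightarrow> (\<exists>j<n. ix q = j \<and> ix q' = j)"
          using q by (simp add: V_def)
        also have "\<dots> \<longleftrightarrow> ix q = ix q'"
          using ix_less[OF q(1)] by auto
        finally show ?thesis .
      qed
      have "\<exists>q. q \<in> {1..k} \<and> ix q = j" if "j < n" for j
      proof -
        have "j \<in> ix ` {1..k}" unfolding ix using that by simp
        then show ?thesis by blast
      qed
      then obtain rep where rep: "\<And>j. j < n \<Longrightarrow> rep j \<in> {1..k} \<and> ix (rep j) = j"
        by metis
      define xs where "xs = map (\<lambda>j. l ! (rep j - 1)) [0..<n]"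
      have "distinct xs"
        unfolding xs_def distinct_map
      proof (intro conjI inj_onI)
        fix i j assume "i \<in> set [0..<n]" "j \<in> set [0..<n]" and eq: "l ! (rep i - 1) = l ! (rep j - 1)"
        then have "i < n" "j < n" by auto
        with rep eq same[of "rep i" "rep j"] show "i = j" by metis
      qed simp
      moreover have "l ! (rep j - 1) \<in> A" if "j < n" for j
      proof -
        have "rep j - 1 < length l" using rep[OF that] l(1) by auto
        then show ?thesis using l(2) nth_mem by blast
      qed
      then have "set xs \<subseteq> A" by (auto simp: xs_def)
      moreover have "build xs = l"
      proof (rule nth_equalityI)
        fix i assume "i < length (build xs)"
        then have i: "Suc i \<in> {1..k}" "i < k" by (auto simp: len)
        have "build xs ! i = l ! (rep (ix (Suc i)) - 1)"
          using ix_less[OF i(1)] i(2) by (simp add: build_def xs_def)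
        also have "\<dots> = l ! (Suc i - 1)"
          using rep[OF ix_less[OF i(1)]] i by (subst same) auto
        finally show "build xs ! i = l ! i" by simp
      qed (simp add: len l)
      moreover have "length xs = n" by (simp add: xs_def)
      ultimately show "l \<in> build ` {xs. length xs = n \<and> distinct xs \<and> set xs \<subseteq> A}"
        by blast
    qed
  qed
  then show ?thesis
    unfolding V_def by (simp add: bij_betw_same_card)
qed

lemma card_lists_word_kernel:
  assumes V: "V \<in> pair_partitions k"
  shows "card {l. length l = k \<and> set l \<subseteq> A \<and> word_kernel l = V}
       = card {xs. length xs = card V \<and> distinct xs \<and> set xs \<subseteq> A}"
proof -
  have part: "partition_on {1..k} V" using V by (simp add: pair_partitions_def)
  obtain h where h: "bij_betw h {..<card V} V"
    using ex_bij_betw_nat_finite[OF card_pair_partition(1)[OF V]] by (auto simp: atLeast0LessThan)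
  have "\<forall>q\<in>{1..k}. \<exists>j<card V. q \<in> h j"
    using part h unfolding partition_on_def bij_betw_def by (metis UnionE imageE lessThan_iff)
  then obtain ix where ix: "\<And>q. q \<in> {1..k} \<Longrightarrow> ix q < card V \<and> q \<in> h (ix q)"
    by metis
  have unique: "i = j" if "i < card V" "j < card V" "q \<in> h i" "q \<in> h j" for i j q
  proof -
    have "h i \<in> V" "h j \<in> V" using h that by (auto simp: bij_betw_def)
    then have "h i = h j" using part that unfolding partition_on_def disjoint_def by blast
    then show ?thesis using h that by (auto simp: bij_betw_def dest: inj_onD)
  qed
  have hj: "{q \<in> {1..k}. ix q = j} = h j" if j: "j < card V" for j
  proof -
    have "h j \<subseteq> {1..k}" using part h j by (auto simp: partition_on_def bij_betw_def)
    then have "q \<in> {1..k} \<and> ix q = j" if "q \<in> h j" for q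
      using that ix[of q] unique[of "ix q" j q] j by blast
    moreover have "q \<in> h j" if "q \<in> {1..k}" "ix q = j" for q
      using ix[OF that(1)] that(2) by simp
    ultimately show ?thesis by blast
  qed
  have "ix ` {1..k} = {..<card V}"
  proof (intro equalityI subsetI)
    fix j assume "j \<in> {..<card V}"
    then have j: "j < card V" by simp
    then have "h j \<in> V" using h by (auto simp: bij_betw_def)
    then have "h j \<noteq> {}" using part by (auto simp: partition_on_def)
    then obtain q where "q \<in> h j" by blast
    then have "q \<in> {q \<in> {1..k}. ix q = j}" unfolding hj[OF j] .
    then show "j \<in> ix ` {1..k}" by blast
  qed (use ix in auto)
  from card_lists_kernel_of_labels[OF this, of A]
  have "card {l. length l = k \<and> set l \<subseteq> A \<and> word_kernel l = (\<lambda>j. {q \<in> {1..k}. ix q = j}) ` {..<card V}}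
      = card {xs. length xs = card V \<and> distinct xs \<and> set xs \<subseteq> A}" .
  also have "(\<lambda>j. {q \<in> {1..k}. ix q = j}) ` {..<card V} = V"
    using hj h by (auto simp: bij_betw_def simp del: atLeastAtMost_iff cong: image_cong_simp)
  finally show ?thesis .
qed

text \<open>
  Such a word is read off from a list of \<open>d\<close> letters, padded if necessary, and a word of length \<open>n\<close>
  in their indices.
\<close>

lemma card_few_letters_le:
  fixes A :: "'a set"
  assumes A: "finite A" "A \<noteq> {}"
  shows "card {l. length l = n \<and> set l \<subseteq> A \<and> card (set l) \<le> d} \<le> d ^ n * card A ^ d"
proof -
  let ?X = "{xs. set xs \<subseteq> A \<and> length xs = d}" and ?Q = "{q. set q \<subseteq> {..<d} \<and> length q = n}"
  obtain a0 where a0: "a0 \<in> A" using A by blast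
  have "{l. length l = n \<and> set l \<subseteq> A \<and> card (set l) \<le> d} \<subseteq> (\<lambda>(xs, q). map ((!) xs) q) ` (?X \<times> ?Q)"
  proof
    fix l assume "l \<in> {l. length l = n \<and> set l \<subseteq> A \<and> card (set l) \<le> d}"
    then have l: "set l \<subseteq> A" "card (set l) \<le> d" "n = length l" by auto
    define xs where "xs = remdups l @ replicate (d - card (set l)) a0"
    have len: "length xs = d" using l by (simp add: xs_def length_remdups_card_conv)
    have "set xs \<subseteq> A" using l a0 by (auto simp: xs_def)
    have "\<forall>a\<in>set l. \<exists>i<d. xs ! i = a"
      unfolding len[symmetric] in_set_conv_nth[symmetric] by (simp add: xs_def)
    then obtain ix where ix: "\<And>a. a \<in> set l \<Longrightarrow> ix a < d \<and> xs ! ix a = a" by metis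
    show "l \<in> (\<lambda>(xs, q). map ((!) xs) q) ` (?X \<times> ?Q)"
    proof (rule image_eqI[of _ _ "(xs, map ix l)"])
      show "l = (case (xs, map ix l) of (xs, q) \<Rightarrow> map ((!) xs) q)"
        using ix by (simp add: map_idI)
    qed (use ix len \<open>set xs \<subseteq> A\<close> l in auto)
  qed
  then have "card {l. length l = n \<and> set l \<subseteq> A \<and> card (set l) \<le> d} \<le> card (?X \<times> ?Q)"
    using A by (intro surj_card_le) (auto intro: finite_lists_length_eq)
  also have "\<dots> = d ^ n * card A ^ d"
    using A by (simp add: card_cartesian_product card_lists_length_eq)
  finally show ?thesis .
qed

section \<open>Concentration of the crossing sums\<close>

text \<open>
  Expanding the square, only the pairs in \<open>Bad\<close> contribute, and each of them at most \<open>1\<close>.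
\<close>

lemma (in prob_space) second_moment_sum_le:
  fixes W :: "'i \<Rightarrow> 'a \<Rightarrow> real"
  assumes L: "finite L" and Bad: "Bad \<subseteq> L \<times> L"
    and meas: "\<And>l. l \<in> L \<Longrightarrow> W l \<in> borel_measurable M"
    and bound: "\<And>l \<omega>. 0 \<le> W l \<omega> \<and> W l \<omega> \<le> 1"
    and uncorr: "\<And>l l'. l \<in> L \<Longrightarrow> l' \<in> L \<Longrightarrow> (l, l') \<notin> Bad \<Longrightarrow>
      expectation (\<lambda>\<omega>. W l \<omega> * W l' \<omega>) = expectation (W l) * expectation (W l')"
  shows "expectation (\<lambda>\<omega>. (\<Sum>l\<in>L. W l \<omega> - expectation (W l))\<^sup>2) \<le> real (card Bad)"
proof -
  define e where "e l = expectation (W l)" for l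
  have int: "integrable M (W l)" if "l \<in> L" for l
    using meas[OF that] bound by (intro integrable_const_bound[of _ 1]) auto
  have e: "0 \<le> e l" "e l \<le> 1" if "l \<in> L" for l
    using bound int[OF that] by (auto simp: e_def intro: integral_ge_const integral_le_const)
  have int2: "integrable M (\<lambda>\<omega>. W l \<omega> * W l' \<omega>)" if "l \<in> L" "l' \<in> L" for l l'
    using meas[OF that(1)] meas[OF that(2)] bound
    by (intro integrable_const_bound[of _ 1]) (auto intro!: mult_le_one simp: abs_mult)
  have expand: "(W l \<omega> - e l) * (W l' \<omega> - e l')
      = W l \<omega> * W l' \<omega> - e l' * W l \<omega> - e l * W l' \<omega> + e l * e l'" for l l' \<omega>
    by (simp add: algebra_simps)
  have int3: "integrable M (\<lambda>\<omega>. (W l \<omega> - e l) * (W l' \<omega> - e l'))" if "l \<in> L" "l' \<in> L" for l l'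
    unfolding expand using int int2 that by simp
  have cov: "expectation (\<lambda>\<omega>. (W l \<omega> - e l) * (W l' \<omega> - e l')) = expectation (\<lambda>\<omega>. W l \<omega> * W l' \<omega>) - e l * e l'"
    if "l \<in> L" "l' \<in> L" for l l'
    unfolding expand using int int2 that by (simp add: e_def prob_space algebra_simps)
  have le1: "expectation (\<lambda>\<omega>. W l \<omega> * W l' \<omega>) \<le> 1" if "l \<in> L" "l' \<in> L" for l l'
    using int2[OF that] bound by (intro integral_le_const) (auto intro!: mult_le_one)
  have "expectation (\<lambda>\<omega>. (\<Sum>l\<in>L. W l \<omega> - e l)\<^sup>2)
      = expectation (\<lambda>\<omega>. \<Sum>z\<in>L \<times> L. (W (fst z) \<omega> - e (fst z)) * (W (snd z) \<omega> - e (snd z)))"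
    by (simp add: power2_eq_square sum_product sum.cartesian_product case_prod_unfold)
  also have "\<dots> = (\<Sum>z\<in>L \<times> L. expectation (\<lambda>\<omega>. (W (fst z) \<omega> - e (fst z)) * (W (snd z) \<omega> - e (snd z))))"
    using int3 by (intro Bochner_Integration.integral_sum) auto
  also have "\<dots> \<le> (\<Sum>z\<in>L \<times> L. if z \<in> Bad then 1 else 0)"
  proof (rule sum_mono)
    fix z assume "z \<in> L \<times> L"
    then obtain l l' where z: "z = (l, l')" "l \<in> L" "l' \<in> L" by auto
    have "expectation (\<lambda>\<omega>. (W l \<omega> - e l) * (W l' \<omega> - e l')) \<le> (if (l, l') \<in> Bad then 1 else 0)"
    proof (cases "(l, l') \<in> Bad")
      case True
      then show ?thesis
        using cov[OF z(2,3)] le1[OF z(2,3)] mult_nonneg_nonneg[OF e(1)[OF z(2)] e(1)[OF z(3)]] by simp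
    next
      case False
      then show ?thesis
        using cov[OF z(2,3)] uncorr[OF z(2,3)] by (simp add: e_def)
    qed
    then show "expectation (\<lambda>\<omega>. (W (fst z) \<omega> - e (fst z)) * (W (snd z) \<omega> - e (snd z)))
        \<le> (if z \<in> Bad then 1 else 0)"
      by (simp only: z(1) fst_conv snd_conv)
  qed
  also have "\<dots> = real (card Bad)"
    using L Bad by (simp add: sum.If_cases Int_absorb1)
  finally show ?thesis by (simp add: e_def)
qed

text \<open>
  The sum of the squares has finite expectation, so it converges almost surely.
\<close>

lemma (in prob_space) AE_tendsto_0_if_second_moments:
  fixes D :: "nat \<Rightarrow> 'a \<Rightarrow> real"
  assumes int: "\<And>n. 0 < n \<Longrightarrow> integrable M (\<lambda>\<omega>. (D n \<omega>)\<^sup>2)"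
    and le: "\<And>n. 0 < n \<Longrightarrow> expectation (\<lambda>\<omega>. (D n \<omega>)\<^sup>2) \<le> C / (real n)\<^sup>2"
  shows "AE \<omega> in M. (\<lambda>n. D n \<omega>) \<longlonglongrightarrow> 0"
proof -
  have C: "0 \<le> C"
    using order_trans[OF integral_nonneg_AE le[of 1]] by simp
  have sum: "summable (\<lambda>n. C / (real (Suc n))\<^sup>2)"
    using summable_mult[OF inverse_power_summable[of 2, where 'a=real], of C]
    by (subst summable_Suc_iff) (simp add: divide_inverse)
  have "(\<integral>\<^sup>+\<omega>. (\<Sum>n. ennreal ((D (Suc n) \<omega>)\<^sup>2)) \<partial>M) = (\<Sum>n. \<integral>\<^sup>+\<omega>. ennreal ((D (Suc n) \<omega>)\<^sup>2) \<partial>M)"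
    using int[THEN borel_measurable_integrable] by (intro nn_integral_suminf) simp
  also have "\<dots> \<le> (\<Sum>n. ennreal (C / (real (Suc n))\<^sup>2))"
  proof (intro suminf_le)
    fix n
    have "(\<integral>\<^sup>+\<omega>. ennreal ((D (Suc n) \<omega>)\<^sup>2) \<partial>M) = ennreal (expectation (\<lambda>\<omega>. (D (Suc n) \<omega>)\<^sup>2))"
      by (intro nn_integral_eq_integral int) auto
    then show "(\<integral>\<^sup>+\<omega>. ennreal ((D (Suc n) \<omega>)\<^sup>2) \<partial>M) \<le> ennreal (C / (real (Suc n))\<^sup>2)"
      using le[of "Suc n"] by (simp add: ennreal_leI)
  qed auto
  also have "\<dots> = ennreal (\<Sum>n. C / (real (Suc n))\<^sup>2)"
    using C sum by (intro suminf_ennreal2) auto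
  finally have "(\<integral>\<^sup>+\<omega>. (\<Sum>n. ennreal ((D (Suc n) \<omega>)\<^sup>2)) \<partial>M) \<noteq> \<infinity>"
    by (auto simp: top_unique)
  then have "AE \<omega> in M. (\<Sum>n. ennreal ((D (Suc n) \<omega>)\<^sup>2)) \<noteq> \<infinity>"
    using int[THEN borel_measurable_integrable] by (intro nn_integral_PInf_AE) auto
  then show ?thesis
  proof eventually_elim
    case (elim \<omega>)
    then have "summable (\<lambda>n. (D (Suc n) \<omega>)\<^sup>2)"
      by (intro summable_suminf_not_top) auto
    then have "(\<lambda>n. (D (Suc n) \<omega>)\<^sup>2) \<longlonglongrightarrow> 0" by (rule summable_LIMSEQ_zero)
    then have "(\<lambda>n. D (Suc n) \<omega>) \<longlonglongrightarrow> 0" by (simp add: power_tendsto_0_iff)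
    then show ?case by (rule LIMSEQ_imp_Suc)
  qed
qed

text \<open>
  The indicator of the event that all pairs in \<open>E\<close> commute, written as a product so that
  independence applies to its expectation.
\<close>

definition commute_weight :: "('a \<Rightarrow> 'a \<Rightarrow> enat) \<Rightarrow> ('a \<times> 'a) set \<Rightarrow> real" where
  "commute_weight m E = (\<Prod>(a, b)\<in>E. if m a b = 2 then 1 else 0)"

lemma commute_weight_eq:
  "finite E \<Longrightarrow> commute_weight m E = (if \<forall>(a, b)\<in>E. m a b = 2 then 1 else 0)"
  unfolding commute_weight_def by (induction E rule: finite_induct) auto

lemma commute_weight_bounds: "0 \<le> commute_weight m E \<and> commute_weight m E \<le> 1"
  unfolding commute_weight_def by (auto intro!: prod_nonneg prod_le_1)

lemma commute_weight_Un:
  "finite E \<Longrightarrow> finite F \<Longrightarrow> E \<inter> F = {} \<Longrightarrow>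
    commute_weight m (E \<union> F) = commute_weight m E * commute_weight m F"
  unfolding commute_weight_def by (rule prod.union_disjoint)

definition crossings :: "'a list \<Rightarrow> ('a \<times> 'a) set" where
  "crossings l = {(a, b). interlaced l a b}"

lemma crossings_subset: "crossings l \<subseteq> set l \<times> set l"
  by (auto simp: crossings_def dest: interlaced_letters)

lemma finite_crossings [simp]: "finite (crossings l)"
  by (rule finite_subset[OF crossings_subset]) simp

lemma crossings_asym:
  assumes "pair_word l" "(a, b) \<in> crossings l"
  shows "(b, a) \<notin> crossings l"
proof
  assume "(b, a) \<in> crossings l"
  then have ba: "interlaced l b a" and ab: "interlaced l a b"
    using assms(2) by (simp_all add: crossings_def)
  have "a \<in> set l" "b \<in> set l" using interlaced_letters[OF ab] by simp_all
  with ab ba show False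
    using interlaced_iff_positions[OF assms(1), of a b] interlaced_iff_positions[OF assms(1), of b a]
    by simp
qed

locale random_commutation = prob_space M for M :: "'w measure" +
  fixes S :: "'a set" and m :: "'w \<Rightarrow> 'a \<Rightarrow> 'a \<Rightarrow> enat" and p :: real
  assumes rv: "\<And>a b. a \<in> S \<Longrightarrow> b \<in> S \<Longrightarrow> (\<lambda>\<omega>. m \<omega> a b) \<in> measurable M (count_space UNIV)"
    and indep: "\<And>P. P \<subseteq> {(a, b). a \<in> S \<and> b \<in> S \<and> a \<noteq> b} \<Longrightarrow>
        (\<forall>a b. (a, b) \<in> P \<longrightarrow> (b, a) \<notin> P) \<Longrightarrow>
        indep_vars (\<lambda>_. count_space UNIV) (\<lambda>(a, b) \<omega>. m \<omega> a b) P"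
    and prob_2: "\<And>a b. a \<in> S \<Longrightarrow> b \<in> S \<Longrightarrow> a \<noteq> b \<Longrightarrow>
        measure M {\<omega> \<in> space M. m \<omega> a b = 2} = p"
begin

lemma measurable_commute_weight:
  assumes "E \<subseteq> S \<times> S"
  shows "(\<lambda>\<omega>. commute_weight (m \<omega>) E) \<in> borel_measurable M"
  unfolding commute_weight_def
proof (rule borel_measurable_prod)
  fix e assume "e \<in> E"
  then have *: "(\<lambda>\<omega>. m \<omega> (fst e) (snd e)) \<in> measurable M (count_space UNIV)"
    using assms by (intro rv) auto
  show "(\<lambda>\<omega>. case e of (a, b) \<Rightarrow> if m \<omega> a b = 2 then 1 else (0::real)) \<in> borel_measurable M"
    unfolding case_prod_unfold by (rule measurable_compose[OF *]) simp
qed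

lemma expectation_commute_weight:
  assumes "finite E" and E: "E \<subseteq> S \<times> S" "\<And>a b. (a, b) \<in> E \<Longrightarrow> a \<noteq> b \<and> (b, a) \<notin> E"
  shows "expectation (\<lambda>\<omega>. commute_weight (m \<omega>) E) = p ^ card E"
proof -
  define Y where "Y e \<omega> = (if m \<omega> (fst e) (snd e) = 2 then 1 else 0 :: real)" for e \<omega>
  have "E \<subseteq> {(a, b). a \<in> S \<and> b \<in> S \<and> a \<noteq> b}"
    using E by auto
  moreover have "\<forall>a b. (a, b) \<in> E \<longrightarrow> (b, a) \<notin> E" using E by auto
  ultimately have "indep_vars (\<lambda>_. count_space UNIV) (\<lambda>(a, b) \<omega>. m \<omega> a b) E"
    by (rule indep)
  then have "indep_vars (\<lambda>_. borel) (\<lambda>e \<omega>. if (case e of (a, b) \<Rightarrow> \<lambda>\<omega>. m \<omega> a b) \<omega> = 2 then 1 else 0 :: real) E"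
    by (rule indep_vars_compose2) simp
  then have ind: "indep_vars (\<lambda>_. borel) Y E"
    by (simp add: Y_def[abs_def] case_prod_unfold)
  have meas: "Y e \<in> borel_measurable M" if "e \<in> E" for e
    using ind that by (simp add: indep_vars_def)
  have EY: "expectation (Y e) = p" if e: "e \<in> E" for e
  proof -
    have eS: "fst e \<in> S" "snd e \<in> S" "fst e \<noteq> snd e" using E e by (cases e; auto)+
    have "expectation (Y e) = expectation (indicator {\<omega> \<in> space M. m \<omega> (fst e) (snd e) = 2})"
      by (intro Bochner_Integration.integral_cong) (auto simp: Y_def)
    also have "\<dots> = p"
      using prob_2[OF eS] by (simp add: Int_def conj_commute)
    finally show ?thesis .
  qed
  have "expectation (\<lambda>\<omega>. commute_weight (m \<omega>) E) = expectation (\<lambda>\<omega>. \<Prod>e\<in>E. Y e \<omega>)"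
    by (simp add: commute_weight_def Y_def case_prod_unfold)
  also have "\<dots> = (\<Prod>e\<in>E. expectation (Y e))"
  proof (rule indep_vars_lebesgue_integral[OF assms(1) ind])
    show "integrable M (Y e)" if "e \<in> E" for e
      using meas[OF that] by (intro integrable_const_bound[of _ 1]) (simp_all add: Y_def)
  qed
  also have "\<dots> = p ^ card E" by (simp add: EY)
  finally show ?thesis .
qed

lemma expectation_crossings:
  assumes "pair_word l" "set l \<subseteq> S"
  shows "expectation (\<lambda>\<omega>. commute_weight (m \<omega>) (crossings l)) = p ^ card (crossings l)"
proof (rule expectation_commute_weight)
  show "crossings l \<subseteq> S \<times> S" using crossings_subset[of l] assms(2) by blast
  show "a \<noteq> b \<and> (b, a) \<notin> crossings l" if "(a, b) \<in> crossings l" for a b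
    using that crossings_asym[OF assms(1) that] by (simp add: crossings_def interlaced_def)
qed simp

text \<open>
  A pair of letters that interlaces in both words, in whichever order, would give two common letters.
  So the pairs of both words together still have independent labels.
\<close>

lemma expectation_crossings_product:
  assumes l: "pair_word l" "set l \<subseteq> S" and l': "pair_word l'" "set l' \<subseteq> S"
    and few: "card (set l \<inter> set l') < 2"
  shows "expectation (\<lambda>\<omega>. commute_weight (m \<omega>) (crossings l) * commute_weight (m \<omega>) (crossings l'))
    = p ^ card (crossings l) * p ^ card (crossings l')"
proof -
  let ?E = "crossings l \<union> crossings l'"
  have sub: "crossings l \<subseteq> set l \<times> set l" "crossings l' \<subseteq> set l' \<times> set l'"
    by (rule crossings_subset)+
  have apart: False if ab: "(a, b) \<in> crossings l" and ba: "(a, b) \<in> crossings l' \<or> (b, a) \<in> crossings l'" for a b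
  proof -
    have "a \<noteq> b" using ab by (simp add: crossings_def interlaced_def)
    moreover have "{a, b} \<subseteq> set l \<inter> set l'" using ab ba sub by auto
    ultimately show False
      using card_mono[of "set l \<inter> set l'" "{a, b}"] few by simp
  qed
  have disj: "crossings l \<inter> crossings l' = {}"
    using apart by auto
  have "expectation (\<lambda>\<omega>. commute_weight (m \<omega>) ?E) = p ^ card ?E"
  proof (rule expectation_commute_weight)
    show "?E \<subseteq> S \<times> S" using sub l(2) l'(2) by blast
    show "a \<noteq> b \<and> (b, a) \<notin> ?E" if ab: "(a, b) \<in> ?E" for a b
    proof
      show "a \<noteq> b" using ab by (auto simp: crossings_def interlaced_def)
      show "(b, a) \<notin> ?E"
        using ab crossings_asym[OF l(1), of a b] crossings_asym[OF l'(1), of a b]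
          apart[of a b] apart[of b a] by blast
    qed
  qed simp
  then show ?thesis
    using disj by (simp add: commute_weight_Un card_Un_disjoint power_add)
qed

text \<open>
  Two words are correlated only if they share two letters.  Concatenation turns such pairs
  injectively into words of length \<open>2 k\<close> with at most \<open>k - 2\<close> letters, of which there are
  \<open>O(N\<^sup>k\<^sup>-\<^sup>2)\<close>; this makes the second moments of order \<open>N\<^sup>-\<^sup>2\<close>.
\<close>

lemma AE_crossing_sums_concentrate:
  fixes A :: "nat \<Rightarrow> 'a set" and k :: nat
  assumes A: "\<And>N. finite (A N)" "\<And>N. A N \<subseteq> S" "\<And>N. card (A N) = N"
  defines "L \<equiv> \<lambda>N. {l. length l = k \<and> set l \<subseteq> A N \<and> pair_word l}"
  shows "AE \<omega> in M. (\<lambda>N. (\<Sum>l\<in>L N. commute_weight (m \<omega>) (crossings l) - p ^ card (crossings l)) / sqrt (real N) ^ k) \<longlonglongrightarrow> 0"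
proof (rule AE_tendsto_0_if_second_moments)
  let ?C = "real ((k - 2) ^ (2 * k))"
  define W where "W l \<omega> = commute_weight (m \<omega>) (crossings l)" for l \<omega>
  fix N :: nat assume N: "0 < N"
  define Bad where "Bad = {(l, l'). l \<in> L N \<and> l' \<in> L N \<and> 2 \<le> card (set l \<inter> set l')}"
  have fin: "finite (L N)"
    by (rule finite_subset[OF _ finite_lists_length_eq[OF A(1)[of N], of k]]) (auto simp: L_def)
  have l: "pair_word l" "set l \<subseteq> S" "length l = k" if "l \<in> L N" for l
    using that A(2) by (auto simp: L_def)
  have meas: "W l \<in> borel_measurable M" if "l \<in> L N" for l
    unfolding W_def using crossings_subset[of l] l(2)[OF that]
    by (intro measurable_commute_weight) blast
  have bound: "0 \<le> W l \<omega> \<and> W l \<omega> \<le> 1" for l \<omega>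
    unfolding W_def by (rule commute_weight_bounds)
  have EW: "expectation (W l) = p ^ card (crossings l)" if "l \<in> L N" for l
    unfolding W_def using l[OF that] by (intro expectation_crossings)
  have square: "((\<Sum>l\<in>L N. W l \<omega> - p ^ card (crossings l)) / sqrt (real N) ^ k)\<^sup>2
      = (\<Sum>l\<in>L N. W l \<omega> - expectation (W l))\<^sup>2 / real N ^ k" for \<omega>
    by (simp add: EW power_divide power_mult[symmetric] mult.commute[of k] power_mult)
  have int: "integrable M (\<lambda>\<omega>. (\<Sum>l\<in>L N. W l \<omega> - expectation (W l))\<^sup>2)"
  proof (rule integrable_const_bound[where B = "(\<Sum>l\<in>L N. 1 + \<bar>expectation (W l)\<bar>)\<^sup>2"])
    have "\<bar>\<Sum>l\<in>L N. W l \<omega> - expectation (W l)\<bar> \<le> (\<Sum>l\<in>L N. 1 + \<bar>expectation (W l)\<bar>)" for \<omega>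
    proof (rule order_trans[OF sum_abs sum_mono])
      show "\<bar>W l \<omega> - expectation (W l)\<bar> \<le> 1 + \<bar>expectation (W l)\<bar>" for l
        using bound[of l \<omega>] by linarith
    qed
    then have "\<bar>\<Sum>l\<in>L N. W l \<omega> - expectation (W l)\<bar>\<^sup>2 \<le> (\<Sum>l\<in>L N. 1 + \<bar>expectation (W l)\<bar>)\<^sup>2" for \<omega>
      by (rule power_mono) simp
    then show "AE \<omega> in M. norm ((\<Sum>l\<in>L N. W l \<omega> - expectation (W l))\<^sup>2) \<le> (\<Sum>l\<in>L N. 1 + \<bar>expectation (W l)\<bar>)\<^sup>2"
      by (intro AE_I2) simp
  qed (use meas in measurable)
  then show "integrable M (\<lambda>\<omega>. ((\<Sum>l\<in>L N. commute_weight (m \<omega>) (crossings l) - p ^ card (crossings l)) / sqrt (real N) ^ k)\<^sup>2)"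
    unfolding W_def[symmetric] square by simp
  have "card Bad * N\<^sup>2 \<le> (k - 2) ^ (2 * k) * N ^ k"
  proof (cases "Bad = {}")
    case False
    then obtain l l' where "l \<in> L N" "2 \<le> card (set l \<inter> set l')"
      by (auto simp: Bad_def)
    moreover from this have "card (set l \<inter> set l') \<le> card (set l)" "2 * card (set l) = k"
      using card_set_pair_word[OF l(1)[of l]] l(3)[of l] by (auto intro: card_mono)
    \<comment> \<open>Guards the exponent \<open>k - 2\<close> against truncation.\<close>
    ultimately have k: "2 \<le> k" by linarith
    let ?F = "{w. length w = 2 * k \<and> set w \<subseteq> A N \<and> card (set w) \<le> k - 2}"
    have "card Bad \<le> card ?F"
    proof (rule card_inj_on_le)
      show "inj_on (\<lambda>(l, l'). l @ l') Bad"
      proof (rule inj_onI, clarify)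
        fix u u' v v' assume uv: "(u, u') \<in> Bad" "(v, v') \<in> Bad" and eq: "u @ u' = v @ v'"
        have "length u = length v" using uv l(3) by (simp add: Bad_def)
        with eq show "u = v \<and> u' = v'" by simp
      qed
      show "(\<lambda>(l, l'). l @ l') ` Bad \<subseteq> ?F"
      proof clarify
        fix l l' assume "(l, l') \<in> Bad"
        then have "l \<in> L N" "l' \<in> L N" "2 \<le> card (set l \<inter> set l')" by (auto simp: Bad_def)
        moreover from this have "2 * card (set l) = k" "2 * card (set l') = k"
          using card_set_pair_word l by metis+
        moreover have "card (set l) + card (set l') = card (set l \<union> set l') + card (set l \<inter> set l')"
          by (rule card_Un_Int) auto
        ultimately show "length (l @ l') = 2 * k \<and> set (l @ l') \<subseteq> A N \<and> card (set (l @ l')) \<le> k - 2"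
          by (auto simp: L_def)
      qed
      show "finite ?F"
        by (rule finite_subset[OF _ finite_lists_length_eq[OF A(1)[of N], of "2 * k"]]) auto
    qed
    also have "\<dots> \<le> (k - 2) ^ (2 * k) * card (A N) ^ (k - 2)"
      using A[of N] N by (intro card_few_letters_le) auto
    finally have "card Bad * N\<^sup>2 \<le> (k - 2) ^ (2 * k) * N ^ (k - 2) * N\<^sup>2"
      by (simp add: A)
    moreover have "N ^ (k - 2) * N\<^sup>2 = N ^ k"
      using k by (metis le_add_diff_inverse2 power_add)
    then have "(k - 2) ^ (2 * k) * N ^ (k - 2) * N\<^sup>2 = (k - 2) ^ (2 * k) * N ^ k"
      by (simp only: mult.assoc)
    ultimately show ?thesis by (simp only:)
  qed simp
  then have "real (card Bad) * (real N)\<^sup>2 \<le> ?C * real N ^ k"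
    by (simp only: of_nat_mult[symmetric] of_nat_power[symmetric] of_nat_le_iff)
  then have card_Bad: "real (card Bad) / real N ^ k \<le> ?C / (real N)\<^sup>2"
    using N by (simp add: field_simps)
  have "expectation (\<lambda>\<omega>. (\<Sum>l\<in>L N. W l \<omega> - expectation (W l))\<^sup>2) \<le> real (card Bad)"
  proof (rule second_moment_sum_le[OF fin])
    show "expectation (\<lambda>\<omega>. W l \<omega> * W l' \<omega>) = expectation (W l) * expectation (W l')"
      if "l \<in> L N" "l' \<in> L N" "(l, l') \<notin> Bad" for l l'
      using that expectation_crossings_product[of l l'] l EW by (auto simp: Bad_def W_def)
  qed (use meas bound in \<open>auto simp: Bad_def\<close>)
  then have "expectation (\<lambda>\<omega>. (\<Sum>l\<in>L N. W l \<omega> - expectation (W l))\<^sup>2) / real N ^ k \<le> ?C / (real N)\<^sup>2"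
    using card_Bad N by (intro order_trans[OF divide_right_mono card_Bad]) auto
  then show "expectation (\<lambda>\<omega>. ((\<Sum>l\<in>L N. commute_weight (m \<omega>) (crossings l) - p ^ card (crossings l)) / sqrt (real N) ^ k)\<^sup>2)
      \<le> ?C / (real N)\<^sup>2"
    unfolding W_def[symmetric] square by simp
qed

end

section \<open>Moments of a sum of generators\<close>

lemma group_algebra_finsum:
  assumes G: "group G" and I: "finite I" and f: "\<And>i. i \<in> I \<Longrightarrow> f i \<in> carrier (group_algebra G)"
  shows "(\<Oplus>\<^bsub>group_algebra G\<^esub>i\<in>I. f i) = (\<lambda>x. \<Sum>i\<in>I. f i x)"
proof -
  interpret A: ring "group_algebra G" by (rule ring_group_algebra[OF G])
  show ?thesis
    using I f
  proof (induction I rule: finite_induct)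
    case empty
    then show ?case unfolding A.finsum_empty by (simp add: group_algebra_def)
  next
    case (insert i I)
    have "(\<Oplus>\<^bsub>group_algebra G\<^esub>i\<in>insert i I. f i) = f i \<oplus>\<^bsub>group_algebra G\<^esub> (\<Oplus>\<^bsub>group_algebra G\<^esub>i\<in>I. f i)"
      using insert by (intro A.finsum_insert) auto
    also have "(\<Oplus>\<^bsub>group_algebra G\<^esub>i\<in>I. f i) = (\<lambda>x. \<Sum>i\<in>I. f i x)"
      using insert by simp
    finally show ?case
      using insert(1,2) by (simp add: group_algebra_def)
  qed
qed

lemma ga_delta_carrier: "x \<in> carrier G \<Longrightarrow> ga_delta x \<in> carrier (group_algebra G)"
  by (auto simp: group_algebra_def ga_supp_def ga_delta_def)

text \<open>
  Pairing a sum of point masses with a function \<open>\<phi>\<close>; the points \<open>h l\<close> may coincide.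
\<close>

lemma sum_ga_delta_mult:
  assumes "finite P" "finite L" "h ` L \<subseteq> P"
  shows "(\<Sum>y\<in>P. (\<Sum>l\<in>L. ga_delta (h l) y) * \<phi> y) = (\<Sum>l\<in>L. \<phi> (h l))"
proof -
  have "(\<Sum>y\<in>P. (\<Sum>l\<in>L. ga_delta (h l) y) * \<phi> y) = (\<Sum>l\<in>L. \<Sum>y\<in>P. ga_delta (h l) y * \<phi> y)"
    by (simp add: sum_distrib_right sum.swap[of _ P])
  also have "\<dots> = (\<Sum>l\<in>L. \<Sum>y\<in>P. if y = h l then \<phi> y else 0)"
    by (intro sum.cong) (auto simp: ga_delta_def)
  also have "\<dots> = (\<Sum>l\<in>L. \<phi> (h l))"
    using assms by (intro sum.cong) auto
  finally show ?thesis .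
qed

lemma ga_supp_delta_sum: "ga_supp (\<lambda>x. c * (\<Sum>l\<in>L. ga_delta (g l) x)) \<subseteq> g ` L"
  by (auto simp: ga_supp_def ga_delta_def elim!: sum.not_neutral_contains_not_neutral split: if_splits)

lemma group_algebra_mult_delta_sums:
  assumes "finite L" "finite K"
  shows "(\<lambda>x. c * (\<Sum>l\<in>L. ga_delta (g l) x)) \<otimes>\<^bsub>group_algebra G\<^esub> (\<lambda>x. d * (\<Sum>k\<in>K. ga_delta (h k) x))
    = (\<lambda>x. c * d * (\<Sum>(l, k)\<in>L \<times> K. ga_delta (g l \<otimes>\<^bsub>G\<^esub> h k) x))"
proof
  fix x
  let ?f = "\<lambda>x. c * (\<Sum>l\<in>L. ga_delta (g l) x)" and ?g = "\<lambda>x. d * (\<Sum>k\<in>K. ga_delta (h k) x)"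
  have "(?f \<otimes>\<^bsub>group_algebra G\<^esub> ?g) x
      = (\<Sum>y\<in>g ` L. \<Sum>z\<in>h ` K. ?f y * ?g z * ga_delta (y \<otimes>\<^bsub>G\<^esub> z) x)"
    using assms by (intro group_algebra_mult_superset ga_supp_delta_sum) auto
  also have "\<dots> = c * d * (\<Sum>y\<in>g ` L. (\<Sum>l\<in>L. ga_delta (g l) y) *
      (\<Sum>z\<in>h ` K. (\<Sum>k\<in>K. ga_delta (h k) z) * ga_delta (y \<otimes>\<^bsub>G\<^esub> z) x))"
    by (simp add: sum_distrib_left mult_ac)
  also have "\<dots> = c * d * (\<Sum>l\<in>L. \<Sum>k\<in>K. ga_delta (g l \<otimes>\<^bsub>G\<^esub> h k) x)"
    using assms by (simp add: sum_ga_delta_mult)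
  finally show "(?f \<otimes>\<^bsub>group_algebra G\<^esub> ?g) x = c * d * (\<Sum>(l, k)\<in>L \<times> K. ga_delta (g l \<otimes>\<^bsub>G\<^esub> h k) x)"
    by (simp add: sum.cartesian_product)
qed

definition word_class :: "'a set \<Rightarrow> ('a \<Rightarrow> 'a \<Rightarrow> enat) \<Rightarrow> 'a list \<Rightarrow> 'a signed_word set" where
  "word_class S m l = pres_rel S (coxeter_relators S m) `` {map (\<lambda>a. (a, True)) l}"

lemma word_class_mult:
  assumes "set u \<subseteq> S" "set v \<subseteq> S"
  shows "word_class S m u \<otimes>\<^bsub>coxeter_group S m\<^esub> word_class S m v = word_class S m (u @ v)"
  using assms by (simp add: word_class_def coxeter_group_def presented_group_mult_class)

lemma word_class_eq_one_iff:
  assumes "set l \<subseteq> S"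
  shows "word_class S m l = \<one>\<^bsub>coxeter_group S m\<^esub> \<longleftrightarrow> cox_word_eq S m l []"
proof -
  have "words_over S \<noteq> {}" "[] \<in> words_over S" by (auto simp: words_over_def)
  then have "word_class S m l = \<one>\<^bsub>coxeter_group S m\<^esub> \<longleftrightarrow>
      (map (\<lambda>a. (a, True)) l, []) \<in> pres_rel S (coxeter_relators S m)"
    using assms by (simp add: word_class_def coxeter_group_def presented_group_def
        eq_equiv_class_iff[OF equiv_pres_rel])
  then show ?thesis by (simp add: cox_word_eq_def pres_rel_def)
qed

lemma lists_length_Suc_snoc:
  "{l. set l \<subseteq> A \<and> length l = Suc k} = (\<lambda>(l, a). l @ [a]) ` ({l. set l \<subseteq> A \<and> length l = k} \<times> A)"
proof (intro equalityI subsetI)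
  fix l assume "l \<in> {l. set l \<subseteq> A \<and> length l = Suc k}"
  then show "l \<in> (\<lambda>(l, a). l @ [a]) ` ({l. set l \<subseteq> A \<and> length l = k} \<times> A)"
    by (cases l rule: rev_cases) auto
qed auto

lemma power_delta_sum:
  fixes S :: "'a set" and m :: "'a \<Rightarrow> 'a \<Rightarrow> enat"
  assumes A: "finite A" "A \<subseteq> S"
  defines "G \<equiv> coxeter_group S m"
  shows "(\<lambda>x. c * (\<Sum>a\<in>A. ga_delta (coxeter_gen S m a) x)) [^]\<^bsub>group_algebra G\<^esub> k
    = (\<lambda>x. c ^ k * (\<Sum>l\<in>{l. set l \<subseteq> A \<and> length l = k}. ga_delta (word_class S m l) x))"
proof (induction k)
  case 0
  have "{l. set l \<subseteq> A \<and> length l = 0} = {[]}" by auto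
  moreover have "\<one>\<^bsub>G\<^esub> = word_class S m []"
    by (simp add: G_def coxeter_group_def presented_group_def word_class_def)
  ultimately show ?case by (simp add: nat_pow_def group_algebra_def)
next
  case (Suc k)
  let ?L = "\<lambda>k. {l. set l \<subseteq> A \<and> length l = k}"
  have gen: "coxeter_gen S m a = word_class S m [a]" for a
    by (simp add: coxeter_gen_def pres_gen_def word_class_def)
  have inj: "inj_on (\<lambda>(l, a). l @ [a]) (?L k \<times> A)"
    by (auto simp: inj_on_def)
  have "(\<lambda>x. c * (\<Sum>a\<in>A. ga_delta (coxeter_gen S m a) x)) [^]\<^bsub>group_algebra G\<^esub> Suc k
      = (\<lambda>x. c ^ k * (\<Sum>l\<in>?L k. ga_delta (word_class S m l) x)) \<otimes>\<^bsub>group_algebra G\<^esub>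
        (\<lambda>x. c * (\<Sum>a\<in>A. ga_delta (coxeter_gen S m a) x))"
    using Suc.IH by (simp add: nat_pow_def)
  also have "\<dots> = (\<lambda>x. c ^ k * c * (\<Sum>(l, a)\<in>?L k \<times> A. ga_delta (word_class S m l \<otimes>\<^bsub>G\<^esub> coxeter_gen S m a) x))"
    using A finite_lists_length_eq[of A k] by (intro group_algebra_mult_delta_sums) auto
  also have "\<dots> = (\<lambda>x. c ^ Suc k * (\<Sum>(l, a)\<in>?L k \<times> A. ga_delta (word_class S m (l @ [a])) x))"
  proof -
    have "word_class S m l \<otimes>\<^bsub>G\<^esub> coxeter_gen S m a = word_class S m (l @ [a])" if "l \<in> ?L k" "a \<in> A" for l a
      unfolding gen G_def using that A(2) by (intro word_class_mult) auto
    then have "(\<Sum>(l, a)\<in>?L k \<times> A. ga_delta (word_class S m l \<otimes>\<^bsub>G\<^esub> coxeter_gen S m a) x)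
        = (\<Sum>(l, a)\<in>?L k \<times> A. ga_delta (word_class S m (l @ [a])) x)" for x
      by (intro sum.cong) auto
    then show ?thesis by (simp add: mult.commute)
  qed
  also have "\<dots> = (\<lambda>x. c ^ Suc k * (\<Sum>l\<in>?L (Suc k). ga_delta (word_class S m l) x))"
    unfolding lists_length_Suc_snoc using inj by (simp add: sum.reindex case_prod_unfold)
  finally show ?case .
qed

text \<open>
  The trace of a power counts the words that represent the identity.
\<close>

lemma trace_power_generator_sum:
  fixes s :: "nat \<Rightarrow> 'a" and m :: "'a \<Rightarrow> 'a \<Rightarrow> enat"
  assumes enum: "bij_betw s {1..} S"
  defines "G \<equiv> coxeter_group S m"
  defines "A \<equiv> group_algebra G"
  shows "canonical_trace G ((c \<odot>\<^bsub>A\<^esub> (\<Oplus>\<^bsub>A\<^esub>i\<in>{1..N}. ga_delta (coxeter_gen S m (s i)))) [^]\<^bsub>A\<^esub> k)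
    = c ^ k * of_nat (card {l. length l = k \<and> set l \<subseteq> s ` {1..N} \<and> cox_word_eq S m l []})"
proof -
  let ?L = "{l. set l \<subseteq> s ` {1..N} \<and> length l = k}"
  have S: "s ` {1..N} \<subseteq> S" and inj: "inj_on s {1..N}"
    using enum by (auto simp: bij_betw_def intro: inj_on_subset)
  have "group G"
    unfolding G_def coxeter_group_def by (rule group_presented_group)
  have gen: "coxeter_gen S m a \<in> carrier G" if "a \<in> S" for a
    using that by (auto simp: coxeter_gen_def pres_gen_def G_def coxeter_group_def presented_group_def
        words_over_def intro!: quotientI)
  have "(\<Oplus>\<^bsub>A\<^esub>i\<in>{1..N}. ga_delta (coxeter_gen S m (s i))) = (\<lambda>x. \<Sum>i\<in>{1..N}. ga_delta (coxeter_gen S m (s i)) x)"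
    unfolding A_def using S by (intro group_algebra_finsum ga_delta_carrier gen \<open>group G\<close>) blast+
  then have "c \<odot>\<^bsub>A\<^esub> (\<Oplus>\<^bsub>A\<^esub>i\<in>{1..N}. ga_delta (coxeter_gen S m (s i)))
      = (\<lambda>x. c * (\<Sum>a\<in>s ` {1..N}. ga_delta (coxeter_gen S m a) x))"
    using inj by (simp add: A_def group_algebra_def sum.reindex)
  then have "canonical_trace G ((c \<odot>\<^bsub>A\<^esub> (\<Oplus>\<^bsub>A\<^esub>i\<in>{1..N}. ga_delta (coxeter_gen S m (s i)))) [^]\<^bsub>A\<^esub> k)
      = c ^ k * (\<Sum>l\<in>?L. ga_delta (word_class S m l) \<one>\<^bsub>G\<^esub>)"
    unfolding canonical_trace_def A_def G_def using power_delta_sum[OF _ S, of m c k] by simp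
  also have "(\<Sum>l\<in>?L. ga_delta (word_class S m l) \<one>\<^bsub>G\<^esub>) = (\<Sum>l\<in>?L. if cox_word_eq S m l [] then 1 else 0)"
  proof (rule sum.cong)
    fix l assume "l \<in> ?L"
    then have "set l \<subseteq> S" using S by auto
    from word_class_eq_one_iff[OF this, of m]
    show "ga_delta (word_class S m l) \<one>\<^bsub>G\<^esub> = (if cox_word_eq S m l [] then 1 else 0)"
      by (auto simp: ga_delta_def G_def)
  qed simp
  also have "\<dots> = of_nat (card (?L \<inter> {l. cox_word_eq S m l []}))"
    by (simp add: sum.If_cases finite_lists_length_eq)
  also have "?L \<inter> {l. cox_word_eq S m l []} = {l. length l = k \<and> set l \<subseteq> s ` {1..N} \<and> cox_word_eq S m l []}"
    by auto
  finally show ?thesis .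
qed

section \<open>The limit of the word counts\<close>

text \<open>
  In a trivial word every letter occurs at least twice.  If some letter occurs more often, twice the
  number of letters is less than \<open>k\<close>.
\<close>

lemma card_trivial_unpaired_le:
  assumes m: "coxeter_matrix S m" and A: "finite A" "A \<subseteq> S" "0 < card A"
  shows "real (card {l. length l = k \<and> set l \<subseteq> A \<and> cox_word_eq S m l [] \<and> \<not> pair_word l}) * sqrt (card A)
    \<le> real (((k - 1) div 2) ^ k) * sqrt (card A) ^ k"
    (is "real (card ?E) * _ \<le> real (?d ^ k) * _")
proof (cases "?E = {}")
  case False
  let ?N = "card A"
  have few: "2 * card (set l) < length l" if l: "cox_word_eq S m l []" "\<not> pair_word l" for l
  proof -
    have ge: "2 \<le> count_list l a" if "a \<in> set l" for a
    proof -
      have "count_list l a \<noteq> 0" using that by (simp add: count_list_0_iff)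
      with trivial_no_single_letter[OF m l(1), of a] show ?thesis by linarith
    qed
    have "(\<Sum>a\<in>set l. 2) < (\<Sum>a\<in>set l. count_list l a)"
    proof (rule sum_strict_mono_ex1)
      obtain a where "a \<in> set l" "count_list l a \<noteq> 2"
        using l(2) by (auto simp: pair_word_def)
      with ge[of a] show "\<exists>a\<in>set l. 2 < count_list l a" by force
    qed (use ge in auto)
    then show ?thesis by (simp add: sum_count_set)
  qed
  from False obtain l0 where "length l0 = k" "cox_word_eq S m l0 []" "\<not> pair_word l0"
    by blast
  with few[of l0] have k: "0 < k" by simp
  have "card ?E \<le> card {l. length l = k \<and> set l \<subseteq> A \<and> card (set l) \<le> ?d}"
  proof (rule card_mono)
    show "finite {l. length l = k \<and> set l \<subseteq> A \<and> card (set l) \<le> ?d}"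
      by (rule finite_subset[OF _ finite_lists_length_eq[OF A(1), of k]]) auto
    show "?E \<subseteq> {l. length l = k \<and> set l \<subseteq> A \<and> card (set l) \<le> ?d}"
    proof
      fix l assume l: "l \<in> ?E"
      with few[of l] have "card (set l) \<le> ?d" by auto
      with l show "l \<in> {l. length l = k \<and> set l \<subseteq> A \<and> card (set l) \<le> ?d}" by simp
    qed
  qed
  also have "\<dots> \<le> ?d ^ k * ?N ^ ?d"
    using A by (intro card_few_letters_le) auto
  finally have "real (card ?E) \<le> real (?d ^ k) * real ?N ^ ?d"
    by (simp only: of_nat_mult[symmetric] of_nat_power[symmetric] of_nat_le_iff)
  also have "real ?N ^ ?d = sqrt ?N ^ (2 * ?d)"
    by (simp add: power_mult)
  also have "sqrt ?N ^ (2 * ?d) \<le> sqrt ?N ^ (k - 1)"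
    using A(3) by (intro power_increasing) auto
  finally have "real (card ?E) * sqrt ?N \<le> real (?d ^ k) * sqrt ?N ^ (k - 1) * sqrt ?N"
    by (simp add: mult_right_mono mult_left_mono)
  also have "\<dots> = real (?d ^ k) * sqrt ?N ^ k"
    using k by (cases k) (simp_all add: mult_ac)
  finally show ?thesis .
next
  case True
  then show ?thesis by (simp only: card.empty) simp
qed

lemma card_trivial_words:
  assumes m: "coxeter_matrix S m" and A: "finite A" "A \<subseteq> S"
  shows "real (card {l. length l = k \<and> set l \<subseteq> A \<and> cox_word_eq S m l []})
    = (\<Sum>l\<in>{l. length l = k \<and> set l \<subseteq> A \<and> pair_word l}. commute_weight m (crossings l))
      + real (card {l. length l = k \<and> set l \<subseteq> A \<and> cox_word_eq S m l [] \<and> \<not> pair_word l})"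
proof -
  let ?P = "{l. length l = k \<and> set l \<subseteq> A \<and> pair_word l}"
  let ?T = "{l. length l = k \<and> set l \<subseteq> A \<and> cox_word_eq S m l []}"
  let ?E = "{l. length l = k \<and> set l \<subseteq> A \<and> cox_word_eq S m l [] \<and> \<not> pair_word l}"
  have fin: "finite X" if "X \<subseteq> {l. set l \<subseteq> A \<and> length l = k}" for X
    using finite_subset[OF that finite_lists_length_eq[OF A(1)]] .
  have "(\<Sum>l\<in>?P. commute_weight m (crossings l)) = (\<Sum>l\<in>?P. if cox_word_eq S m l [] then 1 else 0)"
  proof (rule sum.cong)
    fix l assume "l \<in> ?P"
    then have "set l \<subseteq> S" "pair_word l" using A by auto
    from trivial_pair_word_iff[OF m this]
    show "commute_weight m (crossings l) = (if cox_word_eq S m l [] then 1 else 0)"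
      unfolding commute_weight_eq[OF finite_crossings] by (auto simp: crossings_def)
  qed simp
  also have "\<dots> = real (card (?P \<inter> {l. cox_word_eq S m l []}))"
    using fin[of ?P] by (subst sum.If_cases) auto
  also have "?P \<inter> {l. cox_word_eq S m l []} = ?T - ?E" by auto
  finally have "(\<Sum>l\<in>?P. commute_weight m (crossings l)) = real (card (?T - ?E))" .
  moreover have "card ?T = card (?T - ?E) + card ?E"
  proof -
    have "finite ?T" "finite ?E" by (intro fin; blast)+
    moreover have "?E \<subseteq> ?T" by blast
    ultimately show ?thesis
      using card_Diff_subset[of ?E ?T] card_mono[of ?T ?E] by linarith
  qed
  ultimately show ?thesis by simp
qed

text \<open>
  The count is a product of \<open>r\<close> factors between \<open>N - r\<close> and \<open>N\<close>.
\<close>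

lemma falling_factorial_asymptotics:
  fixes A :: "nat \<Rightarrow> 'a set"
  assumes A: "\<And>N. finite (A N)" "\<And>N. card (A N) = N"
  shows "(\<lambda>N. real (card {xs. length xs = r \<and> distinct xs \<and> set xs \<subseteq> A N}) / real N ^ r) \<longlonglongrightarrow> 1"
proof (rule tendsto_sandwich)
  have bounds: "real (N - r) ^ r \<le> real (card {xs. length xs = r \<and> distinct xs \<and> set xs \<subseteq> A N}) \<and>
      real (card {xs. length xs = r \<and> distinct xs \<and> set xs \<subseteq> A N}) \<le> real N ^ r" if N: "r < N" for N
  proof -
    have card: "card {xs. length xs = r \<and> distinct xs \<and> set xs \<subseteq> A N} = \<Prod>{N - r + 1..N}"
      using card_lists_distinct_length_eq[OF A(1)[of N], of r] N by (simp add: A)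
    have "(\<Prod>i\<in>{N - r + 1..N}. N - r) \<le> (\<Prod>i\<in>{N - r + 1..N}. i)"
      "(\<Prod>i\<in>{N - r + 1..N}. i) \<le> (\<Prod>i\<in>{N - r + 1..N}. N)"
      by (intro prod_mono; auto)+
    then have "(N - r) ^ r \<le> \<Prod>{N - r + 1..N} \<and> \<Prod>{N - r + 1..N} \<le> N ^ r"
      using N by simp
    then show ?thesis
      unfolding card by (simp only: of_nat_power[symmetric] of_nat_le_iff)
  qed
  show "\<forall>\<^sub>F N in sequentially. (1 - real r / real N) ^ r
      \<le> real (card {xs. length xs = r \<and> distinct xs \<and> set xs \<subseteq> A N}) / real N ^ r"
    using eventually_gt_at_top[of r]
  proof eventually_elim
    case (elim N)
    then have "1 - real r / real N = real (N - r) / real N"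
      by (simp add: diff_divide_distrib)
    then have "(1 - real r / real N) ^ r = real (N - r) ^ r / real N ^ r"
      by (simp only: power_divide)
    then show ?case using bounds[OF elim] by (simp add: divide_right_mono)
  qed
  show "\<forall>\<^sub>F N in sequentially. real (card {xs. length xs = r \<and> distinct xs \<and> set xs \<subseteq> A N}) / real N ^ r \<le> 1"
    using eventually_gt_at_top[of r]
  proof eventually_elim
    case (elim N)
    then show ?case using bounds[OF elim] by (simp add: divide_le_eq_1)
  qed
  have "(\<lambda>N. (1 - real r / real N) ^ r) \<longlonglongrightarrow> (1 - 0) ^ r"
    by (intro tendsto_intros lim_const_over_n)
  then show "(\<lambda>N. (1 - real r / real N) ^ r) \<longlonglongrightarrow> 1" by simp
qed simp

text \<open>
  Grouping the words by their kernel \<open>V\<close> leaves, for each pair-partition \<open>V\<close>, a constant weight times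
  a falling factorial of order \<open>N\<^sup>k\<^sup>/\<^sup>2\<close>.  For odd \<open>k\<close> both sides are empty sums.
\<close>

lemma expected_pair_words_tendsto:
  fixes A :: "nat \<Rightarrow> 'a set" and p :: real
  assumes A: "\<And>N. finite (A N)" "\<And>N. card (A N) = N"
  shows "(\<lambda>N. (\<Sum>l\<in>{l. length l = k \<and> set l \<subseteq> A N \<and> pair_word l}. p ^ card (crossings l)) / sqrt (real N) ^ k)
    \<longlonglongrightarrow> (\<Sum>V\<in>pair_partitions k. p ^ card (inversions V))"
proof -
  let ?F = "\<lambda>r N. real (card {xs. length xs = r \<and> distinct xs \<and> set xs \<subseteq> A N})"
  have "(\<Sum>l\<in>{l. length l = k \<and> set l \<subseteq> A N \<and> pair_word l}. p ^ card (crossings l)) / sqrt (real N) ^ k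
      = (\<Sum>V\<in>pair_partitions k. p ^ card (inversions V) * (?F (card V) N / real N ^ card V))" for N
  proof -
    let ?L = "{l. length l = k \<and> set l \<subseteq> A N \<and> pair_word l}"
    have fin: "finite ?L"
      by (rule finite_subset[OF _ finite_lists_length_eq[OF A(1)[of N], of k]]) auto
    have "(\<Sum>l\<in>?L. p ^ card (crossings l)) = (\<Sum>l\<in>?L. p ^ card (inversions (word_kernel l)))"
      by (intro sum.cong) (auto simp: card_inversions_word_kernel crossings_def)
    also have "\<dots> = (\<Sum>V\<in>pair_partitions k. \<Sum>l\<in>{l \<in> ?L. word_kernel l = V}. p ^ card (inversions (word_kernel l)))"
      using fin finite_pair_partitions
      by (intro sum.group[symmetric]) (auto simp: pair_word_iff_word_kernel)
    also have "\<dots> = (\<Sum>V\<in>pair_partitions k. p ^ card (inversions V) * ?F (card V) N)"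
    proof (rule sum.cong)
      fix V assume V: "V \<in> pair_partitions k"
      have "{l \<in> ?L. word_kernel l = V} = {l. length l = k \<and> set l \<subseteq> A N \<and> word_kernel l = V}"
        using V by (auto simp: pair_word_iff_word_kernel)
      then have "card {l \<in> ?L. word_kernel l = V} = card {xs. length xs = card V \<and> distinct xs \<and> set xs \<subseteq> A N}"
        by (simp only: card_lists_word_kernel[OF V])
      moreover have "(\<Sum>l\<in>{l \<in> ?L. word_kernel l = V}. p ^ card (inversions (word_kernel l)))
          = (\<Sum>l\<in>{l \<in> ?L. word_kernel l = V}. p ^ card (inversions V))"
        by (rule sum.cong) auto
      ultimately show "(\<Sum>l\<in>{l \<in> ?L. word_kernel l = V}. p ^ card (inversions (word_kernel l)))
          = p ^ card (inversions V) * ?F (card V) N"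
        by (simp only: sum_constant mult.commute)
    qed simp
    finally have "(\<Sum>l\<in>?L. p ^ card (crossings l)) / sqrt (real N) ^ k
        = (\<Sum>V\<in>pair_partitions k. p ^ card (inversions V) * (?F (card V) N / sqrt (real N) ^ k))"
      by (simp add: sum_divide_distrib)
    also have "\<dots> = (\<Sum>V\<in>pair_partitions k. p ^ card (inversions V) * (?F (card V) N / real N ^ card V))"
    proof (rule sum.cong)
      fix V assume "V \<in> pair_partitions k"
      then have "sqrt (real N) ^ k = real N ^ card V"
        using card_pair_partition(2)[of V k] power_mult[of "sqrt (real N)" 2 "card V"] by simp
      then show "p ^ card (inversions V) * (?F (card V) N / sqrt (real N) ^ k)
          = p ^ card (inversions V) * (?F (card V) N / real N ^ card V)" by simp
    qed simp
    finally show ?thesis .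
  qed
  moreover have "(\<lambda>N. \<Sum>V\<in>pair_partitions k. p ^ card (inversions V) * (?F (card V) N / real N ^ card V))
      \<longlonglongrightarrow> (\<Sum>V\<in>pair_partitions k. p ^ card (inversions V) * 1)"
    using A by (intro tendsto_sum tendsto_mult tendsto_const falling_factorial_asymptotics)
  ultimately show ?thesis by simp
qed

text \<open>
  The count is the sum of the deviation \<open>conc\<close> of the paired words from their mean, of that mean, and
  of the number of trivial words that are not paired, which is smaller by a factor \<open>\<surd>N\<close>.
\<close>

lemma normalised_word_count_tendsto:
  fixes A :: "nat \<Rightarrow> 'a set" and p :: real
  assumes m: "coxeter_matrix S m"
    and A: "\<And>N. finite (A N)" "\<And>N. A N \<subseteq> S" "\<And>N. card (A N) = N"
    and conc: "(\<lambda>N. (\<Sum>l\<in>{l. length l = k \<and> set l \<subseteq> A N \<and> pair_word l}.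
        commute_weight m (crossings l) - p ^ card (crossings l)) / sqrt (real N) ^ k) \<longlonglongrightarrow> 0"
  shows "(\<lambda>N. real (card {l. length l = k \<and> set l \<subseteq> A N \<and> cox_word_eq S m l []}) / sqrt (real N) ^ k)
    \<longlonglongrightarrow> (\<Sum>V\<in>pair_partitions k. p ^ card (inversions V))"
proof -
  let ?C = "real (((k - 1) div 2) ^ k)"
  let ?E = "\<lambda>N. real (card {l. length l = k \<and> set l \<subseteq> A N \<and> cox_word_eq S m l [] \<and> \<not> pair_word l})"
  have "(\<lambda>N. ?E N / sqrt (real N) ^ k) \<longlonglongrightarrow> 0"
  proof (rule tendsto_sandwich[of "\<lambda>_. 0"])
    show "\<forall>\<^sub>F N in sequentially. ?E N / sqrt (real N) ^ k \<le> ?C / sqrt (real N)"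
      using eventually_gt_at_top[of 0]
    proof eventually_elim
      case (elim N)
      then show ?case
        using card_trivial_unpaired_le[OF m A(1,2), of N k] by (simp add: A(3) field_simps)
    qed
    have "filterlim (\<lambda>N. sqrt (real N)) at_top sequentially"
      by (rule filterlim_compose[OF sqrt_at_top filterlim_real_sequentially])
    then show "(\<lambda>N. ?C / sqrt (real N)) \<longlonglongrightarrow> 0"
      by (intro real_tendsto_divide_at_top[OF tendsto_const])
  qed simp_all
  from tendsto_add[OF tendsto_add[OF conc expected_pair_words_tendsto[where A = A and k = k and p = p, OF A(1,3)]] this]
  show ?thesis
    by (simp add: card_trivial_words[OF m A(1,2)] sum_subtractf add_divide_distrib[symmetric])
qed

theorem theorem2:
  fixes M :: "'w measure"
    and S :: "'a set"
    and s :: "nat \<Rightarrow> 'a"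
    and m :: "'w \<Rightarrow> 'a \<Rightarrow> 'a \<Rightarrow> enat"
    and p :: real
  assumes prob: "prob_space M"
    and enum: "bij_betw s {1..} S"
    and rv: "\<And>a b. a \<in> S \<Longrightarrow> b \<in> S \<Longrightarrow> (\<lambda>\<omega>. m \<omega> a b) \<in> measurable M (count_space UNIV)"
    and sym: "AE \<omega> in M. \<forall>a\<in>S. \<forall>b\<in>S. m \<omega> a b = m \<omega> b a"
    and diag: "AE \<omega> in M. \<forall>a\<in>S. m \<omega> a a = 1"
    and indep: "\<And>P. P \<subseteq> {(a, b). a \<in> S \<and> b \<in> S \<and> a \<noteq> b} \<Longrightarrow>
        (\<forall>a b. (a, b) \<in> P \<longrightarrow> (b, a) \<notin> P) \<Longrightarrow>
        prob_space.indep_vars M (\<lambda>_. count_space UNIV) (\<lambda>(a, b) \<omega>. m \<omega> a b) P"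
    and ident: "\<And>a b a' b'. a \<in> S \<Longrightarrow> b \<in> S \<Longrightarrow> a' \<in> S \<Longrightarrow> b' \<in> S \<Longrightarrow>
        a \<noteq> b \<Longrightarrow> a' \<noteq> b' \<Longrightarrow>
        distr M (count_space UNIV) (\<lambda>\<omega>. m \<omega> a b) = distr M (count_space UNIV) (\<lambda>\<omega>. m \<omega> a' b')"
    and p: "0 \<le> p" "p \<le> 1"
    and prob_2: "\<And>a b. a \<in> S \<Longrightarrow> b \<in> S \<Longrightarrow> a \<noteq> b \<Longrightarrow>
        measure M {\<omega> \<in> space M. m \<omega> a b = 2} = p"
    and prob_ge_3: "\<And>a b. a \<in> S \<Longrightarrow> b \<in> S \<Longrightarrow> a \<noteq> b \<Longrightarrow>
        measure M {\<omega> \<in> space M. m \<omega> a b \<ge> 3} = 1 - p"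
  shows "AE \<omega> in M. \<forall>k::nat.
    (let G = coxeter_group S (m \<omega>); A = group_algebra G in
      (\<lambda>N::nat. canonical_trace G
        ((complex_of_real (1 / sqrt (real N)) \<odot>\<^bsub>A\<^esub>
            (\<Oplus>\<^bsub>A\<^esub>i\<in>{1..N}. ga_delta (coxeter_gen S (m \<omega>) (s i)))) [^]\<^bsub>A\<^esub> k)))
      \<longlonglongrightarrow> complex_of_real
          (if odd k then 0 else (\<Sum>V\<in>pair_partitions k. p ^ card (inversions V)))"
proof -
  interpret random_commutation M S m p
    using prob rv indep prob_2
    by (simp add: random_commutation_def random_commutation_axioms_def)
  define A where "A N = s ` {1..N}" for N :: nat
  have "inj_on s {1..N}" for N :: nat
    using enum by (auto simp: bij_betw_def intro: inj_on_subset)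
  then have A: "\<And>N. finite (A N)" "\<And>N. A N \<subseteq> S" "\<And>N. card (A N) = N"
    using enum by (auto simp: A_def card_image bij_betw_def)
  \<comment> \<open>Countability of \<open>S\<close> gives one null set for all pairs of generators.\<close>
  have countable: "countable S"
    using enum countable_image[of "{1..}" s] by (simp add: bij_betw_def)
  \<comment> \<open>The events that the label is 2 and that it is at least 3 exhaust the probability.\<close>
  have ge2: "AE \<omega> in M. a \<noteq> b \<longrightarrow> 2 \<le> m \<omega> a b" if ab: "a \<in> S" "b \<in> S" for a b
  proof (cases "a = b")
    case False
    have meas: "{\<omega> \<in> space M. m \<omega> a b \<in> X} \<in> sets M" for X
      using measurable_sets[OF rv[OF ab], of X] by (simp add: vimage_def Int_def conj_commute)
    have eq: "{\<omega> \<in> space M. 2 \<le> m \<omega> a b} = {\<omega> \<in> space M. m \<omega> a b = 2} \<union> {\<omega> \<in> space M. 3 \<le> m \<omega> a b}"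
    proof -
      have "2 \<le> x \<longleftrightarrow> x = 2 \<or> 3 \<le> x" for x :: enat
        by (cases x) (auto simp: numeral_eq_enat)
      then show ?thesis by auto
    qed
    have "prob {\<omega> \<in> space M. 2 \<le> m \<omega> a b}
        = prob {\<omega> \<in> space M. m \<omega> a b = 2} + prob {\<omega> \<in> space M. 3 \<le> m \<omega> a b}"
      unfolding eq using meas[of "{2}"] meas[of "{3..}"]
      by (intro finite_measure_Union) auto
    then have "prob {\<omega> \<in> space M. 2 \<le> m \<omega> a b} = 1"
      using prob_2[OF ab False] prob_ge_3[OF ab False] by simp
    then have "AE \<omega> in M. \<omega> \<in> {\<omega> \<in> space M. 2 \<le> m \<omega> a b}"
      using AE_in_set_eq_1[of "{\<omega> \<in> space M. 2 \<le> m \<omega> a b}"] meas[of "{2..}"] by simp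
    then show ?thesis by eventually_elim simp
  qed simp
  have "AE \<omega> in M. \<forall>a\<in>S. \<forall>b\<in>S. a \<noteq> b \<longrightarrow> 2 \<le> m \<omega> a b"
    using ge2 by (simp add: AE_ball_countable[OF countable])
  with sym diag have "AE \<omega> in M. coxeter_matrix S (m \<omega>)"
    by eventually_elim (simp add: coxeter_matrix_def)
  moreover have "AE \<omega> in M. \<forall>k. (\<lambda>N. (\<Sum>l\<in>{l. length l = k \<and> set l \<subseteq> A N \<and> pair_word l}.
      commute_weight (m \<omega>) (crossings l) - p ^ card (crossings l)) / sqrt (real N) ^ k) \<longlonglongrightarrow> 0"
    unfolding AE_all_countable using AE_crossing_sums_concentrate[OF A] by blast
  ultimately show ?thesis
  proof eventually_elim
    case (elim \<omega>)
    show ?case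
      unfolding Let_def
    proof
      fix k :: nat
      \<comment> \<open>The case distinction on the parity of \<open>k\<close> disappears, since an odd set has no pair-partition.\<close>
      have "pair_partitions k = {}" if "odd k"
        using card_pair_partition(2)[of _ k] that by fastforce
      then have "(if odd k then 0 else (\<Sum>V\<in>pair_partitions k. p ^ card (inversions V)))
          = (\<Sum>V\<in>pair_partitions k. p ^ card (inversions V))"
        by simp
      moreover have "canonical_trace (coxeter_group S (m \<omega>))
          ((complex_of_real (1 / sqrt (real N)) \<odot>\<^bsub>group_algebra (coxeter_group S (m \<omega>))\<^esub>
            (\<Oplus>\<^bsub>group_algebra (coxeter_group S (m \<omega>))\<^esub>i\<in>{1..N}. ga_delta (coxeter_gen S (m \<omega>) (s i))))
            [^]\<^bsub>group_algebra (coxeter_group S (m \<omega>))\<^esub> k)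
          = complex_of_real (real (card {l. length l = k \<and> set l \<subseteq> A N \<and> cox_word_eq S (m \<omega>) l []}) / sqrt (real N) ^ k)" for N
        unfolding trace_power_generator_sum[OF enum] A_def by (simp add: power_divide)
      ultimately show "(\<lambda>N. canonical_trace (coxeter_group S (m \<omega>))
          ((complex_of_real (1 / sqrt (real N)) \<odot>\<^bsub>group_algebra (coxeter_group S (m \<omega>))\<^esub>
            (\<Oplus>\<^bsub>group_algebra (coxeter_group S (m \<omega>))\<^esub>i\<in>{1..N}. ga_delta (coxeter_gen S (m \<omega>) (s i))))
            [^]\<^bsub>group_algebra (coxeter_group S (m \<omega>))\<^esub> k))
          \<longlonglongrightarrow> complex_of_real
            (if odd k then 0 else (\<Sum>V\<in>pair_partitions k. p ^ card (inversions V)))"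
        using normalised_word_count_tendsto[OF elim(1) A elim(2)[rule_format, of k]]
        by (simp only: tendsto_of_real_iff)
    qed
  qed
qed

end
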